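(* Fix integers $n,N,M\ge 1$. Let $d\mu=\mu(x)\,dx$ be a doubling measure on $\mathbf{R}^n$, with $\mu(2Q)\le C_1\mu(Q)$ for all cubes $Q\subset\mathbf{R}^n$, where $C_1<\infty$. Let $W:\mathbf{R}^n\to\mathcal{L}(\mathbf{R}^N)$ be a measurable matrix-valued function such that $W(x)$ is a positive definite matrix for almost every $x\in\mathbf{R}^n$, and such that for some constant $C_2<\infty$ $$\det\Big(\frac1{\mu(Q)}\int_Q W(x)^2\,d\mu(x)\Big)\le C_2^2\exp\Big(\frac1{\mu(Q)}\int_Q\ln(\det W(x)^2)\,d\mu(x)\Big)$$ uniformly for all cubes $Q\subset\mathbf{R}^n$. Let $E_Q$ and $E_t$ be the $W$-weighted averaging operators defined in the context. Let $(t,x)\mapsto\gamma(t,x)\in\mathcal{L}(\mathbf{R}^N;\mathbf{R}^M)$ be a given measurable matrix-valued function on $\mathbf{R}^{1+n}_+$. Suppose that there exist a family of test functions $b_Q^v\in L_2(\mu)$, one for each dyadic cube $Q\in\mathcal{D}$ and each unit vector $v\in\mathbf{R}^N$, and constants $C_3,C_4<\infty$, such that for all such $Q$ and $v$ $$(v,E_Qb_Q^v)=1,$$ $$\int_{\mathbf{R}^n}|b_Q^v(x)|^2\,d\mu(x)\le C_3^2\,\mu(Q),$$ $$\iint_{\mathbf{R}^{1+n}_+}|\gamma(t,x)E_tb_Q^v(x)|^2\,\frac{dt\,d\mu(x)}{t}\le C_4^2\,\mu(Q).$$ Then the Carleson estimate $$\sup_{Q\in\mathcal{D}}\frac1{\mu(Q)}\iint_{\widehat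 Q}|\gamma(t,x)|^2\,\frac{dt\,d\mu(x)}{t}<\infty$$ holds.
   Context: $\mathbf{R}^{1+n}_+=(0,\infty)\times\mathbf{R}^n$. $L_2(\mu)=L_2(\mathbf{R}^n,\mu;\mathbf{R}^N)$. $|\cdot|$ is the Euclidean norm of vectors and the operator norm of matrices; $(\cdot,\cdot)$ is the Euclidean inner product. Positive definite matrices are symmetric. For a cube $Q$, $\ell(Q)$ is its sidelength, $2Q$ is the concentric cube with sidelength $2\ell(Q)$, and $\mu(Q)=\int_Qd\mu$. $\mathcal{D}$ is the set of standard dyadic cubes in $\mathbf{R}^n$ (sidelengths $2^k$, $k\in\mathbf{Z}$). The Carleson box over $Q\in\mathcal{D}$ is $\widehat Q=(0,\ell(Q))\times Q$. All averages of $W$ and $W^2$ over cubes are understood to be finite. The matrix weighted average is $$E_Qf:=\Big(\int_QW(x)\,d\mu(x)\Big)^{-1}\int_QW(x)f(x)\,d\mu(x)\in\mathbf{R}^N,$$ and the dyadic weighted averaging operator is $E_tf(x):=E_Qf$, where $Q$ is the dyadic cube containing $x$ of sidelength $\ell(Q)=2^k$, with $k\in\mathbf{Z}$ determined by $t\in(2^{k-1},2^k]$. *)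

theory Defs
  imports "HOL-Analysis.Analysis"
begin

text \<open>Axis-parallel cubes are taken half-open, given by lower corner and sidelength. All measures
  below are absolutely continuous, so the choice of boundary faces matters only in that the dyadic
  cubes of one generation are disjoint.\<close>

definition cube :: "real ^ 'n \<Rightarrow> real \<Rightarrow> (real ^ 'n) set" where
  "cube a l = {x. \<forall>i. a $ i \<le> x $ i \<and> x $ i < a $ i + l}"

definition cubes :: "(real ^ 'n) set set" where
  "cubes = {cube a l | a l. 0 < l}"

definition sidelength :: "(real ^ 'n) set \<Rightarrow> real" where
  "sidelength Q = (THE l. 0 < l \<and> (\<exists>a. Q = cube a l))"

definition dyadic_cubes :: "(real ^ 'n) set set" where
  "dyadic_cubes = {cube (\<chi> i. 2 powi k * of_int (m $ i)) (2 powi k) | (k :: int) (m :: int ^ 'n). True}"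

text \<open>The dyadic cube containing \<open>x\<close> whose sidelength \<open>2\<^sup>k\<close> satisfies \<open>2\<^sup>k\<^sup>-\<^sup>1 < t \<le> 2\<^sup>k\<close>;
  it exists and is unique for \<open>t > 0\<close>, see \<open>dyadic_at_ex1\<close>.\<close>

definition dyadic_at :: "real \<Rightarrow> real ^ 'n \<Rightarrow> (real ^ 'n) set" where
  "dyadic_at t x = (THE Q. Q \<in> dyadic_cubes \<and> x \<in> Q \<and>
     (\<exists>k :: int. sidelength Q = 2 powi k \<and> 2 powi (k - 1) < t \<and> t \<le> 2 powi k))"

definition carleson_box :: "(real ^ 'n) set \<Rightarrow> (real \<times> (real ^ 'n)) set" where
  "carleson_box Q = {0<..<sidelength Q} \<times> Q"

text \<open>The measure \<open>\<mu>(x) dx\<close>.\<close>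

definition weighted_measure :: "(real ^ 'n \<Rightarrow> real) \<Rightarrow> (real ^ 'n) measure" where
  "weighted_measure w = density lebesgue (\<lambda>x. ennreal (w x))"

text \<open>The measure \<open>dt d\<mu>(x) / t\<close> on the upper half space, for \<open>d\<mu> = w(x) dx\<close>.\<close>

definition halfspace_measure :: "(real ^ 'n \<Rightarrow> real) \<Rightarrow> (real \<times> (real ^ 'n)) measure" where
  "halfspace_measure w =
     density (lebesgue_on ({0<..} \<times> UNIV)) (\<lambda>(t, x). ennreal (w x / t))"

text \<open>As usual, a doubling measure is nontrivial and locally finite. The cube with lower corner
  \<open>a - (l/2, \<dots>, l/2)\<close> and sidelength \<open>2 l\<close> is concentric with \<open>cube a l\<close>.\<close>

definition doubling :: "real \<Rightarrow> (real ^ 'n) measure \<Rightarrow> bool" where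
  "doubling C \<mu> \<longleftrightarrow>
     (\<forall>Q\<in>cubes. 0 < emeasure \<mu> Q \<and> emeasure \<mu> Q < \<infinity>) \<and>
     (\<forall>a l. 0 < l \<longrightarrow> measure \<mu> (cube (\<chi> i. a $ i - l / 2) (2 * l)) \<le> C * measure \<mu> (cube a l))"

definition positive_definite :: "real ^ 'd ^ 'd \<Rightarrow> bool" where
  "positive_definite A \<longleftrightarrow> transpose A = A \<and> (\<forall>v. v \<noteq> 0 \<longrightarrow> 0 < v \<bullet> (A *v v))"

definition average :: "'a measure \<Rightarrow> 'a set \<Rightarrow> ('a \<Rightarrow> 'b) \<Rightarrow> 'b :: {banach, second_countable_topology}" where
  "average \<mu> Q f = (LINT x:Q|\<mu>. f x) /\<^sub>R measure \<mu> Q"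

text \<open>The exponential of the average of \<open>ln g\<close>, with \<open>exp (-\<infinity>) = 0\<close>. The definition is meant for
  \<open>g > 0\<close> for which the positive part of \<open>ln g\<close> is integrable over \<open>Q\<close>, as is the case for
  \<open>g = det W\<^sup>2\<close> with \<open>W\<^sup>2\<close> integrable; then non-integrability means that the integral is \<open>-\<infinity>\<close>,
  whereas the Bochner integral would return the junk value 0.\<close>

definition geometric_mean :: "'a measure \<Rightarrow> 'a set \<Rightarrow> ('a \<Rightarrow> real) \<Rightarrow> real" where
  "geometric_mean \<mu> Q g =
     (if set_integrable \<mu> Q (\<lambda>x. ln (g x)) then exp (average \<mu> Q (\<lambda>x. ln (g x))) else 0)"

definition L2 :: "'a measure \<Rightarrow> ('a \<Rightarrow> 'b :: euclidean_space) set" where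
  "L2 \<mu> = {f \<in> borel_measurable \<mu>. integrable \<mu> (\<lambda>x. (norm (f x))\<^sup>2)}"

definition weighted_average ::
  "(real ^ 'n) measure \<Rightarrow> (real ^ 'n \<Rightarrow> real ^ 'd ^ 'd) \<Rightarrow> (real ^ 'n) set \<Rightarrow>
   (real ^ 'n \<Rightarrow> real ^ 'd) \<Rightarrow> real ^ 'd" where
  "weighted_average \<mu> W Q f = matrix_inv (LINT x:Q|\<mu>. W x) *v (LINT x:Q|\<mu>. W x *v f x)"

definition dyadic_averaging ::
  "(real ^ 'n) measure \<Rightarrow> (real ^ 'n \<Rightarrow> real ^ 'd ^ 'd) \<Rightarrow> real \<Rightarrow>
   (real ^ 'n \<Rightarrow> real ^ 'd) \<Rightarrow> real ^ 'n \<Rightarrow> real ^ 'd" where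
  "dyadic_averaging \<mu> W t f x = weighted_average \<mu> W (dyadic_at t x) f"

lemma cube_eq_imp_le:
  assumes "0 < l" "cube a l \<subseteq> cube b l'"
  shows "b $ i \<le> a $ i \<and> a $ i + l \<le> b $ i + l'"
proof -
  have "a \<in> cube a l"
    using assms(1) by (simp add: cube_def)
  then have 1: "b $ i \<le> a $ i"
    using assms(2) by (auto simp: cube_def)
  have "a $ i + s < b $ i + l'" if "0 \<le> s" "s < l" for s
  proof -
    have "(\<chi> j. a $ j + s) \<in> cube a l"
      using that by (simp add: cube_def)
    then have "(\<chi> j. a $ j + s) \<in> cube b l'"
      using assms(2) by blast
    then show ?thesis
      by (simp add: cube_def)
  qed
  from this[of "max 0 (b $ i + l' - a $ i)"] this[of 0] have "l \<le> b $ i + l' - a $ i"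
    using assms(1) by (force simp: max_def split: if_splits)
  with 1 show ?thesis by simp
qed

lemma sidelength_cube:
  fixes a :: "real ^ 'n"
  assumes "0 < l"
  shows "sidelength (cube a l) = l"
  unfolding sidelength_def
proof (rule the_equality)
  show "0 < l \<and> (\<exists>b. cube a l = cube b l)"
    using assms by blast
next
  fix l' assume "0 < l' \<and> (\<exists>b. cube a l = cube b l')"
  then obtain b where "0 < l'" "cube a l = cube b l'"
    by blast
  then show "l' = l"
    using cube_eq_imp_le[OF assms, of a b l' undefined] cube_eq_imp_le[of l' b a l undefined] by simp
qed

lemma dyadic_at_ex1:
  fixes x :: "real ^ 'n" and t :: real
  assumes "0 < t"
  shows "\<exists>!Q. Q \<in> dyadic_cubes \<and> x \<in> Q \<and>
    (\<exists>k :: int. sidelength Q = 2 powi k \<and> 2 powi (k - 1) < t \<and> t \<le> 2 powi k)"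
proof -
  have powr: "(2::real) powi j = 2 powr of_int j" for j :: int
    by (simp add: powr_real_of_int')
  have scale: "2 powi (j - 1) < t \<and> t \<le> 2 powi j \<longleftrightarrow> j = \<lceil>log 2 t\<rceil>" for j :: int
  proof -
    have "2 powi (j - 1) < t \<and> t \<le> 2 powi j \<longleftrightarrow> of_int j - 1 < log 2 t \<and> log 2 t \<le> of_int j"
      using assms by (simp add: powr less_log_iff log_le_iff)
    also have "\<dots> \<longleftrightarrow> j = \<lceil>log 2 t\<rceil>"
      using ceiling_eq_iff[of "log 2 t" j] by auto
    finally show ?thesis .
  qed
  define k where "k = \<lceil>log 2 t\<rceil>"
  define l :: real where "l = 2 powi k"
  have l: "0 < l" by (simp add: l_def)
  have mem: "x \<in> cube (\<chi> i. l * of_int (m $ i)) l \<longleftrightarrow> m = (\<chi> i. \<lfloor>x $ i / l\<rfloor>)" for m :: "int ^ 'n"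
  proof -
    have "l * of_int z \<le> y \<and> y < l * of_int z + l \<longleftrightarrow> z = \<lfloor>y / l\<rfloor>" for z y
      using l floor_eq_iff[of "y / l" z] by (auto simp: field_simps)
    then show ?thesis by (simp add: cube_def vec_eq_iff)
  qed
  show ?thesis
  proof (rule ex1I)
    let ?Q = "cube (\<chi> i. l * of_int ((\<chi> i. \<lfloor>x $ i / l\<rfloor>) $ i)) l"
    show "?Q \<in> dyadic_cubes \<and> x \<in> ?Q \<and>
      (\<exists>k :: int. sidelength ?Q = 2 powi k \<and> 2 powi (k - 1) < t \<and> t \<le> 2 powi k)"
    proof (intro conjI)
      show "?Q \<in> dyadic_cubes"
        unfolding dyadic_cubes_def l_def by blast
      show "x \<in> ?Q" using mem by blast
      show "\<exists>k :: int. sidelength ?Q = 2 powi k \<and> 2 powi (k - 1) < t \<and> t \<le> 2 powi k"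
        using scale[of k] sidelength_cube[OF l] by (intro exI[of _ k]) (simp add: l_def k_def)
    qed
  next
    fix Q assume Q: "Q \<in> dyadic_cubes \<and> x \<in> Q \<and>
      (\<exists>k :: int. sidelength Q = 2 powi k \<and> 2 powi (k - 1) < t \<and> t \<le> 2 powi k)"
    then obtain j and m :: "int ^ 'n" where j: "Q = cube (\<chi> i. 2 powi j * of_int (m $ i)) (2 powi j)"
      unfolding dyadic_cubes_def by blast
    have "sidelength Q = 2 powi j"
      unfolding j by (rule sidelength_cube) simp
    moreover have "sidelength Q = l"
      using Q scale unfolding l_def k_def by auto
    ultimately have Qm: "Q = cube (\<chi> i. l * of_int (m $ i)) l"
      using j by simp
    with Q have "m = (\<chi> i. \<lfloor>x $ i / l\<rfloor>)"
      using mem by blast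
    then show "Q = cube (\<chi> i. l * of_int ((\<chi> i. \<lfloor>x $ i / l\<rfloor>) $ i)) l"
      using Qm by simp
  qed
qed

end

theory Submission
  imports Defs
begin

text \<open>
  Write \<open>A\<^sub>Q\<close> and \<open>B\<^sub>Q\<close> for the \<open>\<mu>\<close>-averages of \<open>W\<close> and \<open>W\<^sup>2\<close>. Jensen's inequality for \<open>ln det\<close> and
  the determinant condition give the reverse Hoelder inequality \<open>A\<^sub>Q\<^sup>2 \<le> B\<^sub>Q \<le> C2\<^sup>2 A\<^sub>Q\<^sup>2\<close>.

  Two stopping conditions are used. A cube \<open>R\<close> below \<open>S\<close> leaves the corona of \<open>S\<close> when \<open>A\<^sub>R A\<^sub>S\<^sup>-\<^sup>1\<close> is
  not close to the identity. Such cubes satisfy a Carleson packing condition because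
  \<open>ln det (B - A\<^sup>2/2)\<close> is a concave function of \<open>(A, B)\<close> whose deficit at a stopping step is bounded
  below and whose total variation is bounded by the determinant condition. Within a corona the
  classical local Tb argument applies: one stops when \<open>|E\<^sub>R b|\<close> is large or \<open>(v, E\<^sub>R b)\<close> is small, and
  since \<open>A\<^sub>R A\<^sub>Q\<^sup>-\<^sup>1 v\<close> stays close to \<open>v\<close>, the stopped cubes have mass at most \<open>(1 - \<eta>) \<mu>(Q)\<close>. On cubes
  which are not stopped, \<open>|\<gamma>|\<close> is controlled by \<open>|\<gamma> E\<^sub>t b|\<close>, once each row of \<open>\<gamma>\<close> is restricted to a
  narrow cone around \<open>v\<close>; finitely many cones suffice. Truncating the dyadic tree at a finite depth
  turns both stopping arguments into inductions on the depth.
\<close>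

section \<open>Symmetric and positive definite matrices\<close>

text \<open>What is additive over disjoint cubes is the integral of \<open>W b\<close>, that is
  \<open>m R *\<^sub>R (A R *v E R)\<close>, and not \<open>E R\<close> itself. Pairing it with a
  fixed \<open>u = A_Q^-1 v\<close> recovers \<open>v \<bullet> E R\<close> only on cubes where
  \<open>A R *v u\<close> is still close to \<open>v\<close>, and \<open>A R\<close> may drift
  arbitrarily far over many scales. Hence the local Tb argument has to live inside coronas. The
  factor 1/2 leaves room on both sides: \<open>B/2 <= B - A^2/2 <= B\<close>, so the Bellman
  function stays within a dimensional constant of \<open>ln det B\<close>, while the subtracted
  square still gives a strict gain when \<open>A\<close> moves. Closeness \<open>1/(16 L)\<close>
  puts \<open>A R *v u\<close> within \<open>1/(4 L)\<close> of \<open>v\<close>. Where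
  \<open>|E R| <= L\<close> the error is at most 1/4, so a component below 1/2 leaves at most 3/4 <
  1. The size of \<open>L\<close> makes the cubes with large averages use up only half of the mass
  fraction \<open>1/(64 C3 D K)\<close> saved by the small components.\<close>

lemma transpose_diff: "transpose (A - B) = transpose A - transpose (B :: 'a::ab_group_add^'n^'m)"
  by (simp add: transpose_def vec_eq_iff)

lemma matrix_diff_ldistrib: "A ** (B - C) = A ** B - A ** (C :: real^'n^'m)" for A :: "real^'m^'k"
  by (simp add: matrix_matrix_mult_def vec_eq_iff algebra_simps sum_subtractf)

lemma matrix_diff_rdistrib: "(B - C) ** A = B ** A - C ** (A :: real^'n^'m)" for B :: "real^'m^'k"
  by (simp add: matrix_matrix_mult_def vec_eq_iff algebra_simps sum_subtractf)

lemma matrix_plus_rdistrib: "(B + C) ** A = B ** A + C ** (A :: real^'n^'m)" for B :: "real^'m^'k"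
  by (simp add: matrix_matrix_mult_def vec_eq_iff algebra_simps sum.distrib)

section \<open>Spectral theorem for symmetric matrices\<close>

lemma symmetric_matrix_inner:
  fixes X :: "real^'n^'n"
  assumes "transpose X = X"
  shows "(X *v x) \<bullet> y = x \<bullet> (X *v y)"
  using dot_lmul_matrix[of x X y] vector_transpose_matrix[of x X] assms by simp

text \<open>A maximiser \<open>x\<close> of the quadratic form on the unit sphere of
  \<open>V\<close> has no first variation in the direction of its residual
  \<open>r = l x - X x\<close>, which forces \<open>r = 0\<close>.\<close>

lemma symmetric_matrix_eigenvector:
  fixes X :: "real^'n^'n"
  assumes X: "transpose X = X" and V: "subspace V" "V \<noteq> {0}"
    and inv: "\<And>x. x \<in> V \<Longrightarrow> X *v x \<in> V"
  obtains x l where "x \<in> V" "norm x = 1" "X *v x = l *\<^sub>R x"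
proof -
  let ?S = "V \<inter> sphere 0 1"
  obtain z where z: "z \<in> V" "z \<noteq> 0"
    using V subspace_0 by blast
  then have "z /\<^sub>R norm z \<in> ?S"
    using V by (simp add: subspace_scale)
  moreover have "compact ?S"
    using closed_subspace[OF V(1)] compact_sphere by (metis closed_Int_compact)
  moreover have "continuous_on ?S (\<lambda>x. x \<bullet> (X *v x))"
    by (intro continuous_intros matrix_vector_mult_linear_continuous_on)
  ultimately obtain x where x: "x \<in> ?S" and max: "\<And>y. y \<in> ?S \<Longrightarrow> y \<bullet> (X *v y) \<le> x \<bullet> (X *v x)"
    using continuous_attains_sup[of ?S "\<lambda>x. x \<bullet> (X *v x)"] by blast
  define l where "l = x \<bullet> (X *v x)"
  define q where "q y = l * (y \<bullet> y) - y \<bullet> (X *v y)" for y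
  have nx: "x \<bullet> x = 1" "x \<in> V" "norm x = 1"
    using x by (auto simp: dot_square_norm)
  have q: "0 \<le> q y" if "y \<in> V" for y
  proof (cases "y = 0")
    case False
    then have "y /\<^sub>R norm y \<in> ?S"
      using that V by (simp add: subspace_scale)
    from max[OF this] have "(y \<bullet> (X *v y)) / (norm y)\<^sup>2 \<le> l"
      by (simp add: l_def matrix_vector_mult_scaleR field_simps power2_eq_square)
    then show ?thesis
      using False by (simp add: q_def field_simps dot_square_norm)
  qed (simp add: q_def)
  define r where "r = l *\<^sub>R x - X *v x"
  have r: "r \<in> V"
    unfolding r_def using nx inv V by (simp add: subspace_diff subspace_scale)
  have expand: "q (x + t *\<^sub>R r) = 2 * t * (r \<bullet> r) + t\<^sup>2 * q r" for t
  proof -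
    have 1: "x \<bullet> (X *v r) = (X *v x) \<bullet> r"
      using symmetric_matrix_inner[OF X, of x r] by simp
    have "l * (x \<bullet> r) - (X *v x) \<bullet> r = r \<bullet> r"
      by (metis inner_diff_left inner_scaleR_left r_def)
    then have 2: "(X *v x) \<bullet> r = l * (x \<bullet> r) - r \<bullet> r" by simp
    have "(x + t *\<^sub>R r) \<bullet> (x + t *\<^sub>R r) = 1 + 2 * t * (x \<bullet> r) + t\<^sup>2 * (r \<bullet> r)"
      using nx by (simp add: inner_add_left inner_add_right inner_commute[of r x] power2_eq_square algebra_simps)
    moreover have "(x + t *\<^sub>R r) \<bullet> (X *v (x + t *\<^sub>R r)) = l + 2 * t * ((X *v x) \<bullet> r) + t\<^sup>2 * (r \<bullet> (X *v r))"
      using l_def by (simp add: matrix_vector_right_distrib matrix_vector_mult_scaleR inner_add_left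
          inner_add_right 1 inner_commute[of r "X *v x"] power2_eq_square algebra_simps)
    ultimately show ?thesis
      unfolding q_def 2 by (simp add: algebra_simps)
  qed
  have "r = 0"
  proof (rule ccontr)
    assume "r \<noteq> 0"
    then have rr: "0 < r \<bullet> r" by simp
    have qr: "0 \<le> q r" using q r by blast
    \<comment> \<open>This step makes the form \<open>q\<close>, nonnegative on \<open>V\<close>,
      negative at \<open>x + t r\<close>. The added 1 avoids a division by zero when
      \<open>q r = 0\<close>.\<close>
    define t where "t = - ((r \<bullet> r) / (q r + 1))"
    have "0 \<le> 2 * t * (r \<bullet> r) + t\<^sup>2 * q r"
      using q[of "x + t *\<^sub>R r"] expand r nx V by (simp add: subspace_add subspace_scale)
    also have "\<dots> = (r \<bullet> r)\<^sup>2 * (- q r - 2) / (q r + 1)\<^sup>2"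
      using qr unfolding t_def by (simp add: divide_simps power2_eq_square) (simp add: algebra_simps)
    also have "\<dots> < 0"
      using qr rr by (simp add: divide_neg_pos mult_pos_neg)
    finally show False by simp
  qed
  then show thesis
    using that[OF nx(2,3), of l] unfolding r_def by simp
qed

text \<open>An orthonormal set of eigenvectors of maximal cardinality spans: by symmetry its
  orthogonal complement is invariant, and an eigenvector found there would enlarge the set.\<close>

lemma symmetric_matrix_eigenbasis:
  fixes X :: "real^'n^'n"
  assumes X: "transpose X = X"
  obtains e :: "'n \<Rightarrow> real^'n" and l :: "'n \<Rightarrow> real"
  where "\<And>i j. e i \<bullet> e j = (if i = j then 1 else 0)" "\<And>i. X *v e i = l i *\<^sub>R e i"
proof -
  let ?P = "\<lambda>S. pairwise orthogonal S \<and> (\<forall>x\<in>S. norm x = 1 \<and> (\<exists>l. X *v x = l *\<^sub>R x))"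
  have indep: "independent S" if "?P S" for S
    using that by (intro pairwise_orthogonal_independent) auto
  have bound: "card S \<le> CARD('n)" if "?P S" for S
    using independent_bound[OF indep[OF that]] by simp
  have "?P {}" by (simp add: pairwise_def)
  then obtain S where S: "?P S" and max: "\<And>T. ?P T \<Longrightarrow> card T \<le> card S"
    using ex_has_greatest_nat[of ?P "{}" card "Suc CARD('n)"] bound le_imp_less_Suc by blast
  have fS: "finite S" using independent_bound[OF indep[OF S]] by simp
  define V where "V = {y. \<forall>x\<in>S. orthogonal x y}"
  have V: "subspace V"
    unfolding V_def by (rule subspace_orthogonal_to_vectors)
  have "V = {0}"
  proof (rule ccontr)
    assume "V \<noteq> {0}"
    moreover have "X *v y \<in> V" if "y \<in> V" for y
    proof -
      have "orthogonal x (X *v y)" if "x \<in> S" for x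
      proof -
        obtain l where "X *v x = l *\<^sub>R x" using S \<open>x \<in> S\<close> by blast
        then have "x \<bullet> (X *v y) = l * (x \<bullet> y)"
          using symmetric_matrix_inner[OF X, of x y] by simp
        then show ?thesis using \<open>y \<in> V\<close> that by (simp add: orthogonal_def V_def)
      qed
      then show ?thesis by (simp add: V_def)
    qed
    ultimately obtain x l where x: "x \<in> V" "norm x = 1" "X *v x = l *\<^sub>R x"
      using symmetric_matrix_eigenvector[OF X V] by metis
    have "?P (insert x S)"
      using S x by (auto simp: pairwise_insert V_def orthogonal_commute)
    moreover have "x \<notin> S"
    proof
      assume "x \<in> S"
      then have "orthogonal x x" using x by (auto simp: V_def)
      then show False using x by (simp add: orthogonal_def)
    qed
    ultimately show False
      using max[of "insert x S"] fS by simp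
  qed
  have "span S = UNIV"
  proof (rule ccontr)
    assume "span S \<noteq> UNIV"
    then have "span S \<subset> span UNIV" by auto
    then obtain x where "x \<noteq> 0" "x \<in> span UNIV" and x: "\<And>y. y \<in> span S \<Longrightarrow> orthogonal x y"
      by (rule orthogonal_to_subspace_exists_gen) (rule that)
    have "x \<in> V"
      using x[OF span_base] by (auto simp: V_def orthogonal_commute)
    then show False using \<open>V = {0}\<close> \<open>x \<noteq> 0\<close> by blast
  qed
  then have "dim S = DIM(real^'n)"
    by (metis dim_UNIV dim_span)
  then have "card S = CARD('n)"
    using dim_eq_card_independent[OF indep[OF S]] by simp
  then obtain e where e: "bij_betw e (UNIV::'n set) S"
    using fS finite_same_card_bij[of "UNIV::'n set" S] by auto
  then have eS: "e i \<in> S" for i by (auto simp: bij_betw_def)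
  then have "\<exists>l. X *v e i = l *\<^sub>R e i" for i using S by blast
  then obtain l where "\<And>i. X *v e i = l i *\<^sub>R e i" by metis
  moreover have "e i \<bullet> e j = (if i = j then 1 else 0)" for i j
  proof (cases "i = j")
    case True
    then show ?thesis using S eS[of j] by (simp add: dot_square_norm)
  next
    case False
    then have "e i \<noteq> e j" using e by (auto simp: bij_betw_def inj_on_def)
    then have "orthogonal (e i) (e j)"
      using S eS[of i] eS[of j] pairwiseD by metis
    then show ?thesis using False by (simp add: orthogonal_def)
  qed
  ultimately show thesis using that by blast
qed

text \<open>The interface to diagonalisation: the scalar consequences of an orthonormal eigenbasis,
  by which matrix inequalities reduce to inequalities between the numbers
  \<open>l i\<close>.\<close>

definition eigensystem :: "real^'n^'n \<Rightarrow> ('n \<Rightarrow> real^'n) \<Rightarrow> ('n \<Rightarrow> real) \<Rightarrow> bool" where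
  "eigensystem X e l \<longleftrightarrow> (\<forall>i. norm (e i) = 1) \<and> (\<forall>i. e i \<bullet> (X *v e i) = l i) \<and>
    det X = (\<Prod>i\<in>UNIV. l i) \<and> trace X = (\<Sum>i\<in>UNIV. l i) \<and>
    (\<forall>u. u \<bullet> (X *v u) = (\<Sum>i\<in>UNIV. l i * (e i \<bullet> u)\<^sup>2)) \<and>
    (\<forall>u. u \<bullet> u = (\<Sum>i\<in>UNIV. (e i \<bullet> u)\<^sup>2))"

lemma symmetric_matrix_spectral:
  fixes X :: "real^'n^'n"
  assumes X: "transpose X = X"
  shows "\<exists>e l. eigensystem X e l"
proof -
  obtain e :: "'n \<Rightarrow> real^'n" and l where e: "\<And>i j. e i \<bullet> e j = (if i = j then 1 else 0)"
    and l: "\<And>i. X *v e i = l i *\<^sub>R e i"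
    using symmetric_matrix_eigenbasis[OF X] by blast
  define P :: "real^'n^'n" where "P = (\<chi> i. e i)"
  define d :: "real^'n^'n" where "d = (\<chi> i j. if i = j then l i else 0)"
  have "P ** transpose P = mat 1"
    by (simp add: P_def vec_eq_iff matrix_matrix_mult_def transpose_def mat_def e[unfolded inner_vec_def, simplified])
  then have P: "P ** transpose P = mat 1" "transpose P ** P = mat 1"
    by (simp_all add: matrix_left_right_inverse)
  have Pv: "(P *v u) $ i = e i \<bullet> u" for u i
    by (simp add: P_def matrix_vector_mult_def inner_vec_def)
  have "P ** X ** transpose P = d"
  proof -
    have "(P ** X ** transpose P) $ i $ j = e i \<bullet> (X *v e j)" for i j
    proof -
      have "(P ** X ** transpose P) $ i $ j = ((P ** X ** transpose P) *v axis j 1) $ i"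
        by (simp add: matrix_vector_mul_component inner_axis)
      also have "\<dots> = (P *v (X *v (transpose P *v axis j 1))) $ i"
        by (simp add: matrix_vector_mul_assoc matrix_mul_assoc del: transpose_matrix_vector)
      also have "transpose P *v axis j 1 = e j"
        by (simp add: matrix_vector_mul_component vec_eq_iff inner_axis P_def transpose_def)
      finally show ?thesis by (simp add: Pv)
    qed
    then show ?thesis by (simp add: vec_eq_iff d_def l e)
  qed
  then have Xd: "X = transpose P ** d ** P"
    by (metis P(2) matrix_mul_assoc matrix_mul_lid matrix_mul_rid)
  have "det X = det (transpose P ** P) * det d"
    unfolding Xd det_mul by (simp add: mult_ac)
  then have det: "det X = (\<Prod>i\<in>UNIV. l i)"
    using det_diagonal[of d] by (simp add: P d_def)
  have "trace X = trace (P ** (transpose P ** d))"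
    unfolding Xd by (rule trace_mul_sym)
  then have trace: "trace X = (\<Sum>i\<in>UNIV. l i)"
    by (simp add: matrix_mul_assoc P) (simp add: trace_def d_def)
  have "u \<bullet> (X *v u) = (P *v u) \<bullet> (d *v (P *v u))" for u
    unfolding Xd matrix_vector_mul_assoc[symmetric]
    using dot_lmul_matrix[of u "transpose P" "d *v (P *v u)"] by simp
  moreover have "(d *v y) $ i = l i * y $ i" for y i
    by (simp add: d_def matrix_vector_mult_def if_distrib[of "\<lambda>x. x * _"] cong: if_cong)
  ultimately have quad: "u \<bullet> (X *v u) = (\<Sum>i\<in>UNIV. l i * (e i \<bullet> u)\<^sup>2)" for u
    by (simp add: inner_vec_def[of "P *v u"] Pv power2_eq_square mult_ac)
  have nrm: "u \<bullet> u = (\<Sum>i\<in>UNIV. (e i \<bullet> u)\<^sup>2)" for u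
  proof -
    have "u \<bullet> u = (P *v u) \<bullet> (P *v u)"
      using dot_lmul_matrix[of u "transpose P" "P *v u"] by (simp add: matrix_vector_mul_assoc P)
    also have "\<dots> = (\<Sum>i\<in>UNIV. (e i \<bullet> u)\<^sup>2)"
      by (simp add: inner_vec_def[of "P *v u" "P *v u"] Pv power2_eq_square)
    finally show ?thesis .
  qed
  have "norm (e i) = 1" "e i \<bullet> (X *v e i) = l i" for i
    using e[of i i] by (simp_all add: norm_eq_1 l)
  then show ?thesis
    unfolding eigensystem_def using det trace quad nrm by blast
qed

section \<open>Determinant inequalities read off from eigenvalues\<close>

lemma prod_le_exp_sum:
  fixes l :: "'a \<Rightarrow> real"
  assumes "finite I" "\<And>i. i \<in> I \<Longrightarrow> 0 \<le> l i"
  shows "(\<Prod>i\<in>I. l i) \<le> exp (\<Sum>i\<in>I. l i - 1)"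
  unfolding exp_sum[OF assms(1)]
  using assms exp_ge_add_one_self[of "l _ - 1"] by (intro prod_mono) auto

lemma positive_definite_det_pos: "0 < det D" if "positive_definite D"
proof -
  have sym: "transpose D = D" using that by (simp add: positive_definite_def)
  obtain e l where "eigensystem D e l"
    using symmetric_matrix_spectral[OF sym] by blast
  then have e: "\<And>i. norm (e i) = 1" "\<And>i. e i \<bullet> (D *v e i) = l i" "det D = (\<Prod>i\<in>UNIV. l i)"
    unfolding eigensystem_def by blast+
  have "0 < l i" for i
    using that e(1,2)[of i] by (metis norm_zero positive_definite_def zero_neq_one)
  then show ?thesis by (simp add: e(3) prod_pos)
qed

lemma psd_trace_nonneg:
  fixes X :: "real^'n^'n"
  assumes "transpose X = X" "\<And>u. 0 \<le> u \<bullet> (X *v u)"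
  shows "0 \<le> trace X"
proof -
  obtain e l where "eigensystem X e l"
    using symmetric_matrix_spectral[OF assms(1)] by blast
  then have e: "\<And>i. e i \<bullet> (X *v e i) = l i" "trace X = (\<Sum>i\<in>UNIV. l i)"
    unfolding eigensystem_def by blast+
  then show ?thesis using assms(2) by (metis sum_nonneg)
qed

text \<open>Each eigenvalue satisfies \<open>x <= exp (x - 1)\<close>. After a congruence this
  becomes the concavity of \<open>ln det\<close>.\<close>

lemma psd_det_le_exp_trace:
  fixes X :: "real^'n^'n"
  assumes "transpose X = X" "\<And>u. 0 \<le> u \<bullet> (X *v u)"
  shows "det X \<le> exp (trace X - CARD('n))"
proof -
  obtain e l where "eigensystem X e l"
    using symmetric_matrix_spectral[OF assms(1)] by blast
  then have e: "\<And>i. e i \<bullet> (X *v e i) = l i"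
    "det X = (\<Prod>i\<in>UNIV. l i)"
    "trace X = (\<Sum>i\<in>UNIV. l i)"
    unfolding eigensystem_def by blast+
  have "0 \<le> l i" for i
    using assms(2)[of "e i"] e(1)[of i] by simp
  then show ?thesis
    using prod_le_exp_sum[of UNIV l] by (simp add: e sum_subtractf)
qed

text \<open>All eigenvalues are at least 1, so each is at most their product. This is how a
  determinant bound becomes an operator bound.\<close>

lemma quadratic_form_le_det:
  fixes X :: "real^'n^'n"
  assumes "transpose X = X" "\<And>u. u \<bullet> u \<le> u \<bullet> (X *v u)"
  shows "u \<bullet> (X *v u) \<le> det X * (u \<bullet> u)"
proof -
  obtain e l where "eigensystem X e l"
    using symmetric_matrix_spectral[OF assms(1)] by blast
  then have e: "\<And>i. norm (e i) = 1"
    "\<And>i. e i \<bullet> (X *v e i) = l i"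
    "det X = (\<Prod>i\<in>UNIV. l i)"
    "\<And>u. u \<bullet> (X *v u) = (\<Sum>i\<in>UNIV. l i * (e i \<bullet> u)\<^sup>2)"
    "\<And>u. u \<bullet> u = (\<Sum>i\<in>UNIV. (e i \<bullet> u)\<^sup>2)"
    unfolding eigensystem_def by blast+
  have l: "1 \<le> l i" for i
    using assms(2)[of "e i"] e(1,2)[of i] by (simp add: dot_square_norm)
  have "l i \<le> det X" for i
  proof -
    have "1 \<le> (\<Prod>j\<in>UNIV - {i}. l j)" by (rule prod_ge_1) (rule l)
    moreover have "det X = l i * (\<Prod>j\<in>UNIV - {i}. l j)" by (simp add: e(3) prod.remove[of _ i])
    ultimately show ?thesis using l[of i] by simp
  qed
  then show ?thesis
    unfolding e(4,5) sum_distrib_left by (intro sum_mono mult_right_mono) auto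
qed

lemma positive_definite_factor:
  fixes D :: "real^'n^'n"
  assumes "positive_definite D"
  obtains L :: "real^'n^'n" where "invertible L" "D = transpose L ** L"
proof -
  have sym: "transpose D = D" using assms by (simp add: positive_definite_def)
  obtain e l where "eigensystem D e l"
    using symmetric_matrix_spectral[OF sym] by blast
  then have e: "\<And>i. norm (e i) = 1"
    "\<And>i. e i \<bullet> (D *v e i) = l i"
    "\<And>u. u \<bullet> (D *v u) = (\<Sum>i\<in>UNIV. l i * (e i \<bullet> u)\<^sup>2)"
    unfolding eigensystem_def by blast+
  have l: "0 < l i" for i
    using assms e(1,2)[of i] by (metis norm_zero positive_definite_def zero_neq_one)
  define L :: "real^'n^'n" where "L = (\<chi> i. sqrt (l i) *\<^sub>R e i)"
  have Lv: "(L *v u) $ i = sqrt (l i) * (e i \<bullet> u)" for u i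
    by (simp add: L_def matrix_vector_mult_def inner_vec_def sum_distrib_left mult_ac)
  have quad: "u \<bullet> ((transpose L ** L) *v u) = u \<bullet> (D *v u)" for u
  proof -
    have "u \<bullet> ((transpose L ** L) *v u) = (L *v u) \<bullet> (L *v u)"
      using dot_lmul_matrix[of u "transpose L" "L *v u"] by (simp add: matrix_vector_mul_assoc)
    also have "\<dots> = (\<Sum>i\<in>UNIV. ((L *v u) $ i)\<^sup>2)"
      by (simp add: inner_vec_def[of "L *v u" "L *v u"] power2_eq_square)
    also have "\<dots> = u \<bullet> (D *v u)"
      using l by (simp add: e(3) Lv power_mult_distrib less_imp_le)
    finally show ?thesis .
  qed
  \<comment> \<open>\<open>eigensystem\<close> determines \<open>D\<close> only through its
    quadratic form; polarisation of the symmetric difference \<open>Z\<close> recovers the matrix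
    identity.\<close>
  define Z where "Z = transpose L ** L - D"
  have Zsym: "transpose Z = Z"
    using sym by (simp add: Z_def matrix_transpose_mul transpose_diff)
  have Z0: "u \<bullet> (Z *v u) = 0" for u
    by (simp add: Z_def matrix_vector_mult_diff_rdistrib inner_diff_right quad)
  have "Z *v u = 0" for u
  proof -
    have "x \<bullet> (Z *v u) = 0" for x
      using Z0[of "x + u"] Z0[of x] Z0[of u] symmetric_matrix_inner[OF Zsym, of u x]
      by (simp add: matrix_vector_right_distrib inner_add_left inner_add_right inner_commute)
    then show ?thesis by (metis inner_eq_zero_iff)
  qed
  then have "Z = 0" by (metis matrix_eq matrix_vector_mult_0)
  then have D: "D = transpose L ** L" by (simp add: Z_def)
  then have "det D = det L * det L" by (simp add: det_mul)
  then have "invertible L"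
    using positive_definite_det_pos[OF assms] by (auto simp: invertible_det_nz)
  then show thesis using that D by blast
qed

section \<open>Inequalities relative to a positive definite matrix\<close>

lemma inner_congruence:
  fixes C R :: "real^'n^'n"
  shows "u \<bullet> ((transpose C ** R ** C) *v u) = (C *v u) \<bullet> (R *v (C *v u))"
  using dot_lmul_matrix[of u "transpose C" "R *v (C *v u)"]
  by (simp add: matrix_vector_mul_assoc matrix_mul_assoc)

lemma transpose_congruence:
  fixes C R :: "real^'n^'n"
  assumes "transpose R = R"
  shows "transpose (transpose C ** R ** C) = transpose C ** R ** C"
  using assms by (simp add: matrix_transpose_mul matrix_mul_assoc)

lemma matrix_inv_mult_self:
  fixes A :: "real^'n^'n"
  assumes "invertible A"
  shows "A ** matrix_inv A = mat 1" "matrix_inv A ** A = mat 1"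
proof -
  have "A ** matrix_inv A = mat 1 \<and> matrix_inv A ** A = mat 1"
    using assms unfolding matrix_inv_def invertible_def by (rule someI_ex)
  then show "A ** matrix_inv A = mat 1" "matrix_inv A ** A = mat 1" by auto
qed

lemma positive_definite_invertible: "positive_definite D \<Longrightarrow> invertible D"
  using positive_definite_det_pos[of D] by (simp add: invertible_det_nz)

text \<open>The change of variables \<open>u = L y\<close> turns the form of \<open>D\<close> into
  the Euclidean one, so inequalities relative to \<open>D\<close> reduce to the case of the
  identity.\<close>

lemma positive_definite_whitening:
  fixes D :: "real^'n^'n"
  assumes "positive_definite D"
  shows "\<exists>L :: real^'n^'n. matrix_inv D = L ** transpose L \<and> (det L)\<^sup>2 * det D = 1 \<and>
    (\<forall>u. \<exists>y. u = L *v y \<and> y \<bullet> y = u \<bullet> (D *v u))"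
proof -
  obtain L :: "real^'n^'n" where L: "invertible L" "D = transpose L ** L"
    using positive_definite_factor[OF assms] by blast
  define M where "M = matrix_inv L"
  have M: "L ** M = mat 1" "M ** L = mat 1"
    using matrix_inv_mult_self[OF L(1)] by (auto simp: M_def)
  have Mt: "transpose L ** transpose M = mat 1"
    using M(2) by (metis matrix_transpose_mul transpose_mat)
  have DM: "D ** (M ** transpose M) = mat 1"
    unfolding L(2) by (metis M(1) Mt matrix_mul_assoc matrix_mul_rid)
  then have "matrix_inv D = M ** transpose M"
    by (metis matrix_inv_mult_self(2) positive_definite_invertible[OF assms] matrix_mul_assoc
        matrix_mul_lid matrix_mul_rid)
  moreover have "(det M)\<^sup>2 * det D = 1"
    using arg_cong[OF DM, of det] by (simp add: det_mul power2_eq_square mult_ac)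
  moreover have "\<exists>y. u = M *v y \<and> y \<bullet> y = u \<bullet> (D *v u)" for u
  proof (intro exI conjI)
    show "u = M *v (L *v u)" by (simp add: matrix_vector_mul_assoc M)
    show "(L *v u) \<bullet> (L *v u) = u \<bullet> (D *v u)"
      unfolding L(2) using inner_congruence[of u L "mat 1"] by simp
  qed
  ultimately show ?thesis by blast
qed

lemma det_le_det_exp_trace:
  fixes D R :: "real^'n^'n"
  assumes D: "positive_definite D" and R: "transpose R = R" "\<And>u. 0 \<le> u \<bullet> (R *v u)"
  shows "det R \<le> det D * exp (trace (matrix_inv D ** R) - CARD('n))"
proof -
  obtain L :: "real^'n^'n" where L: "matrix_inv D = L ** transpose L" "(det L)\<^sup>2 * det D = 1"
    using positive_definite_whitening[OF D] by blast
  define X where "X = transpose L ** R ** L"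
  have "det X \<le> exp (trace X - CARD('n))"
    unfolding X_def
    by (intro psd_det_le_exp_trace transpose_congruence R) (simp add: inner_congruence R)
  moreover have "trace X = trace (matrix_inv D ** R)"
    unfolding X_def L(1) by (metis trace_mul_sym matrix_mul_assoc)
  moreover have "det R = det D * det X"
    using L(2) by (simp add: X_def det_mul power2_eq_square mult_ac)
  ultimately show ?thesis
    using positive_definite_det_pos[OF D] by simp
qed

text \<open>The graph of \<open>ln det\<close> lies below its tangent plane at \<open>D\<close>,
  where the gradient is \<open>D^-1\<close>. This gives both Jensen's inequality for the weight and
  the concavity of the Bellman function.\<close>

lemma ln_det_le_ln_det_plus_trace:
  fixes D R :: "real^'n^'n"
  assumes "positive_definite D" "positive_definite R"
  shows "ln (det R) \<le> ln (det D) + trace (matrix_inv D ** R) - CARD('n)"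
proof -
  have "0 \<le> u \<bullet> (R *v u)" for u
    using assms(2) by (cases "u = 0") (auto simp: positive_definite_def less_imp_le)
  then have "det R \<le> det D * exp (trace (matrix_inv D ** R) - CARD('n))"
    using assms by (intro det_le_det_exp_trace) (auto simp: positive_definite_def)
  then have "ln (det R) \<le> ln (det D * exp (trace (matrix_inv D ** R) - CARD('n)))"
    using positive_definite_det_pos assms by (subst ln_le_cancel_iff) auto
  then show ?thesis
    using positive_definite_det_pos[OF assms(1)] by (simp add: ln_mult)
qed

lemma trace_inv_mult_nonneg:
  fixes D P :: "real^'n^'n"
  assumes D: "positive_definite D" and P: "transpose P = P" "\<And>u. 0 \<le> u \<bullet> (P *v u)"
  shows "0 \<le> trace (matrix_inv D ** P)"
proof -
  obtain L :: "real^'n^'n" where L: "matrix_inv D = L ** transpose L"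
    using positive_definite_whitening[OF D] by blast
  have "0 \<le> trace (transpose L ** P ** L)"
    by (intro psd_trace_nonneg transpose_congruence P) (simp add: inner_congruence P)
  also have "\<dots> = trace (matrix_inv D ** P)"
    unfolding L by (metis trace_mul_sym matrix_mul_assoc)
  finally show ?thesis .
qed

lemma norm_matrix_power2:
  fixes X :: "real^'n^'m"
  shows "(norm X)\<^sup>2 = (\<Sum>i\<in>UNIV. (norm (X $ i))\<^sup>2)"
  by (simp add: norm_vec_def L2_set_def sum_nonneg)

text \<open>The norm of the matrix type is the Hilbert-Schmidt norm; Cauchy-Schwarz in each
  row.\<close>

lemma norm_matrix_vector_mult_le:
  fixes X :: "real^'n^'m"
  shows "norm (X *v y) \<le> norm X * norm y"
proof (rule power2_le_imp_le)
  have "(norm (X *v y))\<^sup>2 = (\<Sum>i\<in>UNIV. (X $ i \<bullet> y)\<^sup>2)"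
    by (simp add: norm_vec_def L2_set_def sum_nonneg matrix_vector_mul_component)
  also have "\<dots> \<le> (\<Sum>i\<in>UNIV. (norm (X $ i))\<^sup>2 * (norm y)\<^sup>2)"
    by (intro sum_mono) (metis Cauchy_Schwarz_ineq dot_square_norm)
  also have "\<dots> = (norm X * norm y)\<^sup>2"
    by (simp add: norm_matrix_power2 power_mult_distrib sum_distrib_right)
  finally show "(norm (X *v y))\<^sup>2 \<le> (norm X * norm y)\<^sup>2" .
qed simp

lemma trace_transpose_mult_self:
  fixes X :: "real^'n^'n"
  shows "trace (transpose X ** X) = (norm X)\<^sup>2"
proof -
  have "trace (X ** transpose X) = (norm X)\<^sup>2"
    by (simp add: norm_matrix_power2 trace_def matrix_matrix_mult_def transpose_def
        dot_square_norm[symmetric] inner_vec_def)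
  then show ?thesis by (metis trace_mul_sym)
qed

text \<open>With \<open>D^-1 = L L^T\<close> the trace is the squared Hilbert-Schmidt norm of
  \<open>Z L\<close>, and \<open>u = L y\<close> with \<open>|y|^2\<close> equal to the form of
  \<open>D\<close> at \<open>u\<close>. This bounds the gain of the Bellman function from
  below.\<close>

lemma norm_mult_le_trace_inv:
  fixes D Z :: "real^'n^'n"
  assumes D: "positive_definite D" and Z: "transpose Z = Z"
  shows "(norm (Z *v u))\<^sup>2 \<le> trace (matrix_inv D ** (Z ** Z)) * (u \<bullet> (D *v u))"
proof -
  obtain L :: "real^'n^'n" where L: "matrix_inv D = L ** transpose L"
    and "\<exists>y. u = L *v y \<and> y \<bullet> y = u \<bullet> (D *v u)"
    using positive_definite_whitening[OF D] by blast
  then obtain y where y: "u = L *v y" "y \<bullet> y = u \<bullet> (D *v u)" by blast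
  have "norm (Z *v u) \<le> norm (Z ** L) * norm y"
    unfolding y(1) matrix_vector_mul_assoc by (rule norm_matrix_vector_mult_le)
  then have "(norm (Z *v u))\<^sup>2 \<le> (norm (Z ** L))\<^sup>2 * (y \<bullet> y)"
    by (metis power_mono norm_ge_zero power_mult_distrib dot_square_norm)
  moreover have "(norm (Z ** L))\<^sup>2 = trace (matrix_inv D ** (Z ** Z))"
  proof -
    have "(norm (Z ** L))\<^sup>2 = trace (transpose L ** (Z ** Z) ** L)"
      by (simp add: trace_transpose_mult_self[symmetric] matrix_transpose_mul Z matrix_mul_assoc)
    also have "\<dots> = trace (matrix_inv D ** (Z ** Z))"
      unfolding L by (metis trace_mul_sym matrix_mul_assoc)
    finally show ?thesis .
  qed
  ultimately show ?thesis by (simp add: y(2))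
qed

text \<open>The congruence of \<open>B\<close> by \<open>A^-1\<close> is at least the identity and
  has determinant at most \<open>K\<close>; hence its form is at most \<open>K\<close>.\<close>

lemma quadratic_form_le_norm_of_det_le:
  fixes A B :: "real^'n^'n"
  assumes A: "positive_definite A" and B: "transpose B = B"
    and AB: "\<And>u. (norm (A *v u))\<^sup>2 \<le> u \<bullet> (B *v u)" and det: "det B \<le> K * (det A)\<^sup>2"
  shows "u \<bullet> (B *v u) \<le> K * (norm (A *v u))\<^sup>2"
proof -
  define C where "C = matrix_inv A"
  have AC: "A ** C = mat 1" and CA: "C ** A = mat 1"
    using matrix_inv_mult_self[OF positive_definite_invertible[OF A]] by (auto simp: C_def)
  define X where "X = transpose C ** B ** C"
  have "y \<bullet> y \<le> y \<bullet> (X *v y)" for y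
    unfolding X_def inner_congruence using AB[of "C *v y"]
    by (simp add: matrix_vector_mul_assoc AC dot_square_norm)
  then have "y \<bullet> (X *v y) \<le> det X * (y \<bullet> y)" for y
    by (intro quadratic_form_le_det) (auto simp: X_def transpose_congruence[OF B])
  moreover have "C *v (A *v u) = u" by (simp add: matrix_vector_mul_assoc CA)
  ultimately have "u \<bullet> (B *v u) \<le> det X * (norm (A *v u))\<^sup>2"
    using \<open>\<And>y. y \<bullet> (X *v y) \<le> det X * (y \<bullet> y)\<close>[of "A *v u"]
    by (simp add: X_def inner_congruence dot_square_norm)
  moreover have "det X \<le> K"
  proof -
    have "det C * det A = 1" using arg_cong[OF CA, of det] by (simp add: det_mul)
    moreover have "det X = (det C)\<^sup>2 * det B" by (simp add: X_def det_mul power2_eq_square)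
    ultimately show ?thesis
      using mult_left_mono[OF det, of "(det C)\<^sup>2"] by (simp add: power_mult_distrib[symmetric] mult_ac)

  qed
  ultimately show ?thesis
    by (meson mult_right_mono order_trans zero_le_power2)
qed

lemma symmetric_matrixI:
  fixes X :: "real^'n^'n"
  assumes "\<And>u v. u \<bullet> (X *v v) = v \<bullet> (X *v u)"
  shows "transpose X = X"
proof -
  have "X $ i $ j = X $ j $ i" for i j
    using assms[of "axis i 1" "axis j 1"]
    by (simp add: inner_axis' matrix_vector_mul_component inner_axis)
  then show ?thesis by (simp add: transpose_def vec_eq_iff)
qed

lemma positive_definite_square:
  fixes X :: "real^'n^'n"
  assumes "positive_definite X"
  shows "positive_definite (X ** X)" "u \<bullet> ((X ** X) *v u) = (norm (X *v u))\<^sup>2"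
    "(X *v u) \<bullet> y = u \<bullet> (X *v y)" "trace (X ** X) = (norm X)\<^sup>2" "0 < det X"
proof -
  have sym: "transpose X = X" using assms by (simp add: positive_definite_def)
  show sq: "u \<bullet> ((X ** X) *v u) = (norm (X *v u))\<^sup>2" for u
    using symmetric_matrix_inner[OF sym, of u "X *v u"]
    by (simp add: matrix_vector_mul_assoc[symmetric] dot_square_norm)
  have "X *v u \<noteq> 0" if "u \<noteq> 0" for u
    using assms that by (fastforce simp: positive_definite_def)
  then show "positive_definite (X ** X)"
    unfolding positive_definite_def sq by (simp add: matrix_transpose_mul sym)
  show "(X *v u) \<bullet> y = u \<bullet> (X *v y)" by (rule symmetric_matrix_inner[OF sym])
  show "trace (X ** X) = (norm X)\<^sup>2" using trace_transpose_mult_self[of X] by (simp add: sym)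
  show "0 < det X" by (rule positive_definite_det_pos[OF assms])
qed

lemma trace_inv_self: "positive_definite X \<Longrightarrow> trace (matrix_inv X ** X) = CARD('n)" for X :: "real^'n^'n"
  using matrix_inv_mult_self(2)[OF positive_definite_invertible[of X]] by (simp add: trace_I)

section \<open>Stopping arguments on a tree\<close>

text \<open>In the application \<open>m\<close> is the measure of a cube, \<open>A\<close> and
  \<open>B\<close> are the averages of \<open>W\<close> and \<open>W^2\<close>, and \<open>J\<close>
  is the integral, not the average, of \<open>ln det W^2\<close>. \<open>D\<close> compares a cube
  with its children, \<open>K\<close> is the reverse Hoelder constant, and \<open>c\<close> comes
  from the determinant condition.\<close>

locale weighted_tree =
  fixes ch :: "'q \<Rightarrow> 'q set" and m :: "'q \<Rightarrow> real"
    and A B :: "'q \<Rightarrow> real^'N^'N" and J :: "'q \<Rightarrow> real" and D K c :: real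
  assumes m_pos: "0 < m Q"
    and m_children: "(\<Sum>R\<in>ch Q. m R) = m Q"
    and m_doubling: "R \<in> ch Q \<Longrightarrow> m Q \<le> D * m R"
    and A_children: "(\<Sum>R\<in>ch Q. m R *\<^sub>R A R) = m Q *\<^sub>R A Q"
    and B_children: "(\<Sum>R\<in>ch Q. m R *\<^sub>R B R) = m Q *\<^sub>R B Q"
    and J_children: "(\<Sum>R\<in>ch Q. J R) = J Q"
    and A_pd: "positive_definite (A Q)"
    and B_sym: "transpose (B Q) = B Q"
    and A_le_B: "(norm (A Q *v u))\<^sup>2 \<le> u \<bullet> (B Q *v u)"
    and B_le_A: "u \<bullet> (B Q *v u) \<le> K * (norm (A Q *v u))\<^sup>2"
    and J_le: "J Q \<le> m Q * ln (det (B Q))"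
    and le_J: "m Q * ln (det (B Q)) \<le> J Q + c * m Q"
    and D_ge_1: "1 \<le> D" and K_ge_1: "1 \<le> K"
begin

section \<open>Truncated sums over the tree\<close>

lemma finite_children: "finite (ch Q)"
  \<comment> \<open>A sum over an infinite set is 0 by convention, but \<open>m Q\<close> is
    positive.\<close>
  using m_children[of Q] m_pos[of Q] sum.infinite by fastforce

text \<open>Runs over the connected piece of \<open>P\<close> hanging from \<open>Q\<close>: a cube
  in \<open>P\<close> below a cube outside \<open>P\<close> is not counted.\<close>

primrec psum :: "('q \<Rightarrow> bool) \<Rightarrow> ('q \<Rightarrow> real) \<Rightarrow> nat \<Rightarrow> 'q \<Rightarrow> real" where
  "psum P g 0 Q = (if P Q then g Q else 0)"
| "psum P g (Suc n) Q = (if P Q then g Q + (\<Sum>R\<in>ch Q. psum P g n R) else 0)"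

text \<open>Runs over the stopping cubes, the first ones outside \<open>P\<close>. Branches still in
  \<open>P\<close> when the depth is exhausted contribute 0.\<close>

primrec bsum :: "('q \<Rightarrow> bool) \<Rightarrow> ('q \<Rightarrow> real) \<Rightarrow> nat \<Rightarrow> 'q \<Rightarrow> real" where
  "bsum P f 0 Q = (if P Q then 0 else f Q)"
| "bsum P f (Suc n) Q = (if P Q then (\<Sum>R\<in>ch Q. bsum P f n R) else f Q)"

lemma psum_not: "\<not> P Q \<Longrightarrow> psum P g n Q = 0"
  by (cases n) auto

lemma bsum_not: "\<not> P Q \<Longrightarrow> bsum P f n Q = f Q"
  by (cases n) auto

text \<open>Stopping cubes are disjoint subcubes of \<open>Q\<close>; on an abstract tree this is
  expressed by the superadditivity of \<open>F\<close>.\<close>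

lemma bsum_le:
  assumes "\<And>R. \<not> P R \<Longrightarrow> f R \<le> F R" "\<And>R. 0 \<le> F R" "\<And>R. (\<Sum>R'\<in>ch R. F R') \<le> F R"
  shows "bsum P f n Q \<le> F Q"
proof (induction n arbitrary: Q)
  case (Suc n)
  then show ?case
    using assms order_trans[OF sum_mono[of "ch Q" "bsum P f n" F] assms(3)[of Q]] by auto
qed (use assms in auto)

lemma bsum_add: "bsum P (\<lambda>R. f R + f' R) n Q = bsum P f n Q + bsum P f' n Q"
  by (induction n arbitrary: Q) (auto simp: sum.distrib)

lemma psum_mono:
  assumes "\<And>R. P R \<Longrightarrow> P' R" "\<And>R. P R \<Longrightarrow> g R \<le> g' R" "\<And>R. 0 \<le> g' R"
  shows "psum P g n Q \<le> psum P' g' n Q"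
proof -
  have nonneg: "0 \<le> psum P' g' n Q" for n Q
    using assms(3) by (induction n arbitrary: Q) (auto intro: sum_nonneg add_nonneg_nonneg)
  show ?thesis
  proof (induction n arbitrary: Q)
    case (Suc n)
    then show ?case
      using assms nonneg[of "Suc n" Q] by (auto intro!: add_mono sum_mono)
  qed (use assms in auto)
qed

lemma psum_scale: "psum P (\<lambda>R. k * g R) n Q = k * psum P g n Q"
  by (induction n arbitrary: Q) (auto simp: sum_distrib_left distrib_left)

lemma A_sym: "transpose (A Q) = A Q"
  using A_pd[of Q] by (simp add: positive_definite_def)

lemma A_inv: "A Q *v (matrix_inv (A Q) *v u) = u"
  using matrix_inv_mult_self[OF positive_definite_invertible[OF A_pd]]
  by (simp add: matrix_vector_mul_assoc)

lemma A_eq_0: "A Q *v u = 0 \<Longrightarrow> u = 0"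
  using A_pd[of Q] by (fastforce simp: positive_definite_def)

lemma B_pd: "positive_definite (B Q)"
  unfolding positive_definite_def
proof (intro conjI allI impI B_sym)
  fix u :: "real^'N" assume "u \<noteq> 0"
  then have "0 < (norm (A Q *v u))\<^sup>2" using A_eq_0 by auto
  then show "0 < u \<bullet> (B Q *v u)" using A_le_B[of Q u] by linarith
qed

lemma B_nonneg: "0 \<le> u \<bullet> (B Q *v u)"
  using A_le_B[of Q u] zero_le_power2 order_trans by blast

text \<open>The child contributes one term of a nonnegative sum, and doubling bounds the ratio of
  the masses.\<close>

lemma B_child_le:
  assumes "R \<in> ch Q"
  shows "u \<bullet> (B R *v u) \<le> D * (u \<bullet> (B Q *v u))"
proof -
  have "m R * (u \<bullet> (B R *v u)) \<le> (\<Sum>R'\<in>ch Q. m R' * (u \<bullet> (B R' *v u)))"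
    using assms finite_children m_pos B_nonneg by (intro member_le_sum) (auto simp: less_imp_le)
  also have "\<dots> = u \<bullet> ((\<Sum>R'\<in>ch Q. m R' *\<^sub>R B R') *v u)"
  proof -
    have "linear (\<lambda>X. u \<bullet> (X *v u))"
      by (rule linearI) (auto simp: matrix_vector_mult_add_rdistrib inner_add_right
          scaleR_matrix_vector_assoc[symmetric])
    from linear_sum[OF this, of "\<lambda>R'. m R' *\<^sub>R B R'" "ch Q"] linear_scale[OF this]
    show ?thesis by simp
  qed
  also have "\<dots> = m Q * (u \<bullet> (B Q *v u))"
    by (simp add: B_children scaleR_matrix_vector_assoc[symmetric])
  also have "\<dots> \<le> (D * m R) * (u \<bullet> (B Q *v u))"
    using m_doubling[OF assms] B_nonneg by (intro mult_right_mono) auto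
  finally show ?thesis
    using m_pos[of R] by (simp add: mult_ac)
qed

text \<open>Says that the operator norm of \<open>A_R A_S^-1 - 1\<close> is at most
  \<open>\<delta>\<close>, without inverses.\<close>

definition near :: "real \<Rightarrow> 'q \<Rightarrow> 'q \<Rightarrow> bool" where
  "near \<delta> S R \<longleftrightarrow> (\<forall>u. norm (A R *v u - A S *v u) \<le> \<delta> * norm (A S *v u))"

lemma near_refl: "0 \<le> \<delta> \<Longrightarrow> near \<delta> S S"
  by (simp add: near_def)

text \<open>The corona is centred at \<open>S\<close>, but a test function belongs to
  \<open>Q\<close>; closeness has to be measured from \<open>Q\<close>.\<close>

lemma near_near:
  assumes "near \<delta> S Q" "near \<delta> S R" "0 \<le> \<delta>" "\<delta> \<le> 1/2"
  shows "norm (A R *v u - A Q *v u) \<le> 4 * \<delta> * norm (A Q *v u)"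
proof -
  have 1: "norm (A R *v u - A S *v u) \<le> \<delta> * norm (A S *v u)"
    "norm (A Q *v u - A S *v u) \<le> \<delta> * norm (A S *v u)"
    using assms by (auto simp: near_def)
  have "norm (A S *v u) \<le> norm (A Q *v u) + norm (A Q *v u - A S *v u)"
    by (metis norm_minus_commute norm_triangle_sub)
  moreover have "\<delta> * norm (A S *v u) \<le> 1/2 * norm (A S *v u)"
    using assms by (intro mult_right_mono) auto
  ultimately have 2: "norm (A S *v u) \<le> 2 * norm (A Q *v u)"
    using 1 by linarith
  have "norm (A R *v u - A Q *v u) \<le> norm (A R *v u - A S *v u) + norm (A Q *v u - A S *v u)"
    by (metis dist_norm dist_triangle2)
  also have "\<dots> \<le> 2 * \<delta> * norm (A S *v u)" using 1 by linarith
  also have "\<dots> \<le> 2 * \<delta> * (2 * norm (A Q *v u))"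
    using 2 assms by (intro mult_left_mono) auto
  finally show ?thesis by simp
qed

text \<open>A test function \<open>b\<close> for the cube \<open>Q\<close> enters through its weighted averages \<open>E R\<close>, through
  \<open>a R\<close>, the integral of \<open>|b|\<^sup>2\<close> over \<open>R\<close>, and through \<open>h R\<close>, the integral of \<open>|\<gamma> E\<^sub>t b|\<^sup>2\<close> over the
  upper half of the Carleson box of \<open>R\<close>. The fifth condition is Young's inequality for \<open>\<integral>\<^sub>R (W u, b)\<close>.\<close>

definition test :: "'q \<Rightarrow> real^'N \<Rightarrow> real \<Rightarrow> real \<Rightarrow> ('q \<Rightarrow> real^'N) \<Rightarrow> ('q \<Rightarrow> real) \<Rightarrow> ('q \<Rightarrow> real) \<Rightarrow> bool"
  where
  "test Q v C3 C4 E a h \<longleftrightarrow>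
    v \<bullet> E Q = 1 \<and>
    (\<forall>P. (\<Sum>R\<in>ch P. m R *\<^sub>R (A R *v E R)) = m P *\<^sub>R (A P *v E P)) \<and>
    (\<forall>R. 0 \<le> a R) \<and> (\<forall>P. (\<Sum>R\<in>ch P. a R) \<le> a P) \<and>
    (\<forall>R u s. 0 < s \<longrightarrow>
      m R * (u \<bullet> (A R *v E R)) \<le> s / 2 * (m R * (u \<bullet> (B R *v u))) + a R / (2 * s)) \<and>
    a Q \<le> C3 * m Q \<and>
    (\<forall>R. 0 \<le> h R) \<and> (\<forall>n. psum (\<lambda>_. True) h n Q \<le> C4 * m Q)"

section \<open>The local Tb argument within a corona\<close>

lemma test_average_bound:
  assumes "test Q v C3 C4 E a h"
  shows "m R * (norm (E R))\<^sup>2 \<le> K * a R"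
proof -
  define u where "u = matrix_inv (A R) *v E R"
  have Au: "A R *v u = E R" by (simp add: u_def A_inv)
  have inner: "u \<bullet> (A R *v E R) = (norm (E R))\<^sup>2"
    using symmetric_matrix_inner[OF A_sym, of R u "E R"] by (simp add: Au dot_square_norm)
  \<comment> \<open>Young's inequality with parameter \<open>1/K\<close>: by the reverse Hoelder
    bound its first term is at most half of the left-hand side and can be absorbed.\<close>
  have "0 < 1 / K" using K_ge_1 by simp
  then have "m R * (u \<bullet> (A R *v E R)) \<le> (1/K) / 2 * (m R * (u \<bullet> (B R *v u))) + a R / (2 * (1/K))"
    using assms unfolding test_def by blast
  also have "(1/K) / 2 * (m R * (u \<bullet> (B R *v u))) \<le> (1/K) / 2 * (m R * (K * (norm (E R))\<^sup>2))"
    using B_le_A[of u R] m_pos[of R] K_ge_1 by (intro mult_left_mono) (auto simp: Au)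
  also have "(1/K) / 2 * (m R * (K * (norm (E R))\<^sup>2)) = m R * (norm (E R))\<^sup>2 / 2"
    using K_ge_1 by simp
  also have "a R / (2 * (1/K)) = K * a R / 2" by simp
  finally show ?thesis by (simp add: inner)
qed

definition bad :: "real \<Rightarrow> real^'N \<Rightarrow> ('q \<Rightarrow> real^'N) \<Rightarrow> 'q \<Rightarrow> bool" where
  "bad L v E R \<longleftrightarrow> L < norm (E R) \<or> v \<bullet> E R < 1/2"

text \<open>Chebyshev: a cube with \<open>|E R| > L\<close> has mass at most \<open>K / L^2\<close>
  times its energy \<open>a R\<close>, and the energies of disjoint cubes add up to at most
  \<open>C3 * m Q\<close>.\<close>

lemma stopped_mass_large_average:
  assumes T: "test Q v C3 C4 E a h" and L: "128 * C3\<^sup>2 * D * K\<^sup>2 \<le> L\<^sup>2" "1 \<le> L" "1 \<le> C3"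
    and f: "\<And>R. \<not> P R \<Longrightarrow> f R \<le> (if L < norm (E R) then m R else 0)"
  shows "bsum P f n Q \<le> m Q / (128 * C3 * D * K)"
proof -
  have a: "\<And>R. 0 \<le> a R" "\<And>P. (\<Sum>R\<in>ch P. a R) \<le> a P" "a Q \<le> C3 * m Q"
    using T by (auto simp: test_def)
  have "bsum P f n Q \<le> K / L\<^sup>2 * a Q"
  proof (rule bsum_le)
    fix R assume "\<not> P R"
    have "m R \<le> K / L\<^sup>2 * a R" if "L < norm (E R)"
    proof -
      have "m R * L\<^sup>2 \<le> m R * (norm (E R))\<^sup>2"
        using that L m_pos[of R] by (intro mult_left_mono power_mono) auto
      also have "\<dots> \<le> K * a R" by (rule test_average_bound[OF T])
      finally show ?thesis using L by (simp add: field_simps)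
    qed
    then show "f R \<le> K / L\<^sup>2 * a R"
      using f[OF \<open>\<not> P R\<close>] a(1)[of R] K_ge_1 by (auto split: if_splits intro: order_trans)
  next
    show "(\<Sum>R\<in>ch P. K / L\<^sup>2 * a R) \<le> K / L\<^sup>2 * a P" for P
      unfolding sum_distrib_left[symmetric] using a(2) K_ge_1 by (intro mult_left_mono) auto
  qed (use a K_ge_1 in auto)
  also have "\<dots> \<le> K / L\<^sup>2 * (C3 * m Q)"
    using a K_ge_1 by (intro mult_left_mono) auto
  also have "\<dots> \<le> K / (128 * C3\<^sup>2 * D * K\<^sup>2) * (C3 * m Q)"
    using L K_ge_1 D_ge_1 m_pos[of Q] by (intro mult_right_mono divide_left_mono) auto
  also have "\<dots> = m Q / (128 * C3 * D * K)"
    using L K_ge_1 by (simp add: power2_eq_square)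
  finally show ?thesis .
qed

text \<open>The doubling condition controls \<open>B R\<close> also for the cubes \<open>R\<close> just outside the region where \<open>A\<close> is
  nearly constant. This makes a self-improved reverse Hoelder inequality unnecessary.\<close>

lemma stopped_mass_small_component:
  assumes T: "test Q v C3 C4 E a h" and L: "1 \<le> L" "1 \<le> C3" and v: "norm v = 1"
    and Q: "near (1 / (16 * L)) S Q"
    and P: "P = (\<lambda>R. near (1 / (16 * L)) S R \<and> \<not> bad L v E R)"
    and f: "\<And>R. \<not> P R \<Longrightarrow> f R = 0 \<or>
      f R = m R \<and> near (1 / (16 * L)) S R \<and> norm (E R) \<le> L \<and> v \<bullet> E R < 1/2"
  shows "bsum P f n Q \<le> m Q - m Q / (64 * C3 * D * K)"
proof -
  let ?near = "near (1 / (16 * L)) S"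
  have TE: "v \<bullet> E Q = 1" "\<And>P. (\<Sum>R\<in>ch P. m R *\<^sub>R (A R *v E R)) = m P *\<^sub>R (A P *v E P)"
    and Ta: "\<And>R. 0 \<le> a R" "\<And>P. (\<Sum>R\<in>ch P. a R) \<le> a P" "a Q \<le> C3 * m Q"
    and Ty: "\<And>R u s. 0 < s \<Longrightarrow>
      m R * (u \<bullet> (A R *v E R)) \<le> s / 2 * (m R * (u \<bullet> (B R *v u))) + a R / (2 * s)"
    using T unfolding test_def by blast+
  \<comment> \<open>For this \<open>u\<close> the number \<open>u \<bullet> (A R *v E R)\<close> is
    1 at \<open>R = Q\<close> and close to \<open>v \<bullet> E R\<close> on near cubes with bounded
    average, while its product with \<open>m R\<close> is additive along the tree.\<close>
  define u where "u = matrix_inv (A Q) *v v"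
  have Au: "A Q *v u = v" by (simp add: u_def A_inv)
  have Anear: "norm (A R *v u - v) \<le> 1 / (4 * L)" if "?near R" for R
    using near_near[OF Q that, of u] L by (simp add: Au v field_simps)
  have Bnear: "u \<bullet> (B R *v u) \<le> 4 * K" if "?near R" for R
  proof -
    have "norm (A R *v u) \<le> norm v + norm (A R *v u - v)" by (rule norm_triangle_sub)
    also have "\<dots> \<le> 2"
      using Anear[OF that] v L order_trans[of "norm (A R *v u - v)" "1 / (4 * L)" 1] by simp
    finally have "K * (norm (A R *v u))\<^sup>2 \<le> K * 2\<^sup>2"
      using K_ge_1 by (intro mult_left_mono power_mono) auto
    then show ?thesis using B_le_A[of u R] by simp
  qed
  define X where "X = 4 * D * K"
  have X: "u \<bullet> (B R *v u) \<le> X" if "?near R \<or> (\<exists>p. R \<in> ch p \<and> ?near p)" for R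
    using that
  proof
    assume "?near R"
    moreover have "4 * K \<le> X" using D_ge_1 K_ge_1 by (simp add: X_def)
    ultimately show ?thesis using Bnear by fastforce
  next
    assume "\<exists>p. R \<in> ch p \<and> ?near p"
    then obtain p where "R \<in> ch p" "?near p" by blast
    then have "u \<bullet> (B R *v u) \<le> D * (u \<bullet> (B p *v u))" "D * (u \<bullet> (B p *v u)) \<le> D * (4 * K)"
      using B_child_le Bnear D_ge_1 by (auto intro: mult_left_mono)
    then show ?thesis by (simp add: X_def)
  qed
  \<comment> \<open>Makes the energy term \<open>a Q / (2 * s)\<close> at most
    \<open>m Q / 8\<close>. With the factor 3/4 on the stopped mass, 1/8 of \<open>m Q\<close> is
    left for the remaining mass to supply.\<close>
  define s where "s = 4 * C3"
  have s: "0 < s" using L by (simp add: s_def)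
  have young: "m R * (u \<bullet> (A R *v E R)) \<le> s / 2 * X * m R + a R / (2 * s)"
    if "?near R \<or> (\<exists>p. R \<in> ch p \<and> ?near p)" for R
  proof -
    have "s / 2 * (m R * (u \<bullet> (B R *v u))) \<le> s / 2 * (m R * X)"
      using X[OF that] s m_pos[of R] by (intro mult_left_mono) auto
    then show ?thesis using Ty[OF s, of R u] by (simp add: mult_ac)
  qed
  \<comment> \<open>A counted cube carries at most 3/4 of its mass, 1/2 from the stopping condition
    and 1/4 from \<open>A R *v u - v\<close>. For the others only Young's inequality is
    available.\<close>
  have outside: "m R * (u \<bullet> (A R *v E R)) \<le> 3/4 * f R + s / 2 * X * (m R - f R) + a R / (2 * s)"
    if R: "?near R \<or> (\<exists>p. R \<in> ch p \<and> ?near p)" "\<not> P R" for R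
  proof (cases "f R = 0")
    case True
    then show ?thesis using young[OF R(1)] by simp
  next
    case False
    then have fR: "f R = m R" "?near R" "norm (E R) \<le> L" "v \<bullet> E R < 1/2"
      using f[OF R(2)] by auto
    have "u \<bullet> (A R *v E R) = (A R *v u) \<bullet> E R"
      using symmetric_matrix_inner[OF A_sym, of R u "E R"] by simp
    also have "\<dots> = (A R *v u - v) \<bullet> E R + v \<bullet> E R" by (simp add: inner_diff_left)
    also have "(A R *v u - v) \<bullet> E R \<le> norm (A R *v u - v) * norm (E R)" by (rule norm_cauchy_schwarz)
    also have "\<dots> \<le> 1 / (4 * L) * L" using Anear[OF fR(2)] fR(3) L by (intro mult_mono) auto
    finally have "u \<bullet> (A R *v E R) \<le> 3/4" using L fR(4) by simp
    then have "m R * (u \<bullet> (A R *v E R)) \<le> m R * (3/4)"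
      using m_pos[of R] by (intro mult_left_mono) auto
    moreover have "0 \<le> a R / (2 * s)" using Ta s by simp
    ultimately show ?thesis by (simp add: fR(1))
  qed
  \<comment> \<open>The induction must also reach the children of near cubes, since a stopped cube
    may lie just outside the corona.\<close>
  have main: "m R * (u \<bullet> (A R *v E R))
      \<le> 3/4 * bsum P f n R + s / 2 * X * (m R - bsum P f n R) + a R / (2 * s)"
    if "?near R \<or> (\<exists>p. R \<in> ch p \<and> ?near p)" for R
    using that
  proof (induction n arbitrary: R)
    case 0
    then show ?case using outside[of R] young[of R] by auto
  next
    case (Suc n)
    show ?case
    proof (cases "P R")
      case False
      then show ?thesis using outside[OF Suc.prems] by simp
    next
      case True
      then have "?near R" by (simp add: P)
      have "m R * (u \<bullet> (A R *v E R)) = u \<bullet> (\<Sum>R'\<in>ch R. m R' *\<^sub>R (A R' *v E R'))"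
        by (simp add: TE)
      also have "\<dots> = (\<Sum>R'\<in>ch R. m R' * (u \<bullet> (A R' *v E R')))"
        by (simp add: inner_sum_right)
      also have "\<dots> \<le> (\<Sum>R'\<in>ch R. 3/4 * bsum P f n R' + s / 2 * X * (m R' - bsum P f n R') + a R' / (2 * s))"
        using Suc.IH \<open>?near R\<close> by (intro sum_mono) blast
      also have "\<dots> = 3/4 * (\<Sum>R'\<in>ch R. bsum P f n R') + s / 2 * X * (m R - (\<Sum>R'\<in>ch R. bsum P f n R'))
          + (\<Sum>R'\<in>ch R. a R') / (2 * s)"
        by (simp add: sum.distrib sum_subtractf sum_distrib_left[symmetric] sum_divide_distrib[symmetric] m_children)
      also have "(\<Sum>R'\<in>ch R. a R') / (2 * s) \<le> a R / (2 * s)"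
        using Ta(2)[of R] s by (simp add: divide_right_mono)
      finally show ?thesis using True by simp
    qed
  qed
  have "u \<bullet> (A Q *v E Q) = 1"
    using symmetric_matrix_inner[OF A_sym, of Q u "E Q"] by (simp add: Au TE)
  moreover have "a Q / (2 * s) \<le> m Q / 8"
    using Ta(3) L by (simp add: s_def field_simps)
  moreover have "s / 2 * X = 8 * C3 * D * K" by (simp add: s_def X_def)
  ultimately have "m Q \<le> 3/4 * bsum P f n Q + 8 * C3 * D * K * (m Q - bsum P f n Q) + m Q / 8"
    using main[of Q] Q by simp
  moreover have "bsum P f n Q \<le> m Q"
  proof (rule bsum_le)
    show "f R \<le> m R" if "\<not> P R" for R
      using f[OF that] m_pos[of R] by auto
  qed (auto simp: m_children m_pos less_imp_le)
  ultimately have "m Q / 8 \<le> 8 * C3 * D * K * (m Q - bsum P f n Q)"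
    by simp
  moreover have "0 < 8 * C3 * D * K"
    using L D_ge_1 K_ge_1 by simp
  ultimately have "m Q / 8 / (8 * C3 * D * K) \<le> m Q - bsum P f n Q"
    by (simp add: pos_divide_le_eq mult_ac)
  then show ?thesis by simp
qed

text \<open>A saving of 1/64 minus a loss of 1/128. Cubes that leave the corona get weight 0; their
  cost is borne by the packing argument.\<close>

lemma stopped_mass:
  assumes T: "test Q v C3 C4 E a h" and L: "128 * C3\<^sup>2 * D * K\<^sup>2 \<le> L\<^sup>2" "1 \<le> L" "1 \<le> C3"
    and v: "norm v = 1" and Q: "near (1 / (16 * L)) S Q"
  defines "P \<equiv> \<lambda>R. near (1 / (16 * L)) S R \<and> \<not> bad L v E R"
  shows "bsum P (\<lambda>R. if near (1 / (16 * L)) S R then m R else 0) n Q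
    \<le> (1 - 1 / (128 * C3 * D * K)) * m Q"
proof -
  let ?near = "near (1 / (16 * L)) S"
  let ?large = "\<lambda>R. if ?near R \<and> L < norm (E R) then m R else 0"
  let ?small = "\<lambda>R. if ?near R \<and> \<not> L < norm (E R) \<and> v \<bullet> E R < 1/2 then m R else 0"
  have split: "bsum P (\<lambda>R. if ?near R then m R else 0) n R = bsum P (\<lambda>R. ?large R + ?small R) n R" for R
    by (induction n arbitrary: R) (auto simp: P_def bad_def)
  have "bsum P ?large n Q \<le> m Q / (128 * C3 * D * K)"
    using m_pos by (intro stopped_mass_large_average[OF T L]) (simp add: less_imp_le)
  moreover have "bsum P ?small n Q \<le> m Q - m Q / (64 * C3 * D * K)"
    by (rule stopped_mass_small_component[OF T L(2,3) v Q]) (auto simp: P_def)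
  moreover have "m Q / (64 * C3 * D * K) = 2 * (m Q / (128 * C3 * D * K))"
    by simp
  ultimately show ?thesis
    unfolding split bsum_add by (simp add: algebra_simps)
qed

text \<open>A cube is never stopped by its own test function, so restarting at stopped cubes goes
  strictly down the tree.\<close>

lemma test_not_bad:
  assumes T: "test Q v C3 C4 E a h" and L: "128 * C3\<^sup>2 * D * K\<^sup>2 \<le> L\<^sup>2" "1 \<le> L" "1 \<le> C3"
  shows "\<not> bad L v E Q"
proof -
  have a: "a Q \<le> C3 * m Q" and v: "v \<bullet> E Q = 1" using T by (auto simp: test_def)
  have "K * a Q \<le> K * (C3 * m Q)" using a K_ge_1 by (intro mult_left_mono) auto
  then have "m Q * (norm (E Q))\<^sup>2 \<le> m Q * (K * C3)"
    using test_average_bound[OF T, of Q] by (simp add: mult_ac)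
  then have 1: "(norm (E Q))\<^sup>2 \<le> K * C3" using m_pos[of Q] by simp
  have "1 \<le> D * K"
    using D_ge_1 K_ge_1 mult_mono[of 1 D 1 K] by simp
  then have "1 \<le> C3 * (D * K)"
    using L(3) mult_mono[of 1 C3 1 "D * K"] by simp
  then have "1 * (K * C3) \<le> (128 * (C3 * (D * K))) * (K * C3)"
    using K_ge_1 L(3) by (intro mult_right_mono) auto
  moreover have "(128 * (C3 * (D * K))) * (K * C3) = 128 * C3\<^sup>2 * D * K\<^sup>2"
    by (simp add: power2_eq_square)
  ultimately have "(norm (E Q))\<^sup>2 \<le> L\<^sup>2" using 1 L(1) by linarith
  then have "norm (E Q) \<le> L" using L(2) power2_le_imp_le by fastforce
  then show ?thesis using v by (simp add: bad_def)
qed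

text \<open>The unstopped cubes contribute at most \<open>16 * C4 * m Q\<close>; each stopped cube
  restarts with its own test function in the same corona. With
  \<open>\<eta> = 1 / (128 * C3 * D * K)\<close> the constant solves
  \<open>16 C4 + (1 - \<eta>) \<kappa> = \<kappa>\<close>.\<close>

lemma corona_bound:
  fixes L C3 C4 :: real
  assumes L: "128 * C3\<^sup>2 * D * K\<^sup>2 \<le> L\<^sup>2" "1 \<le> L" "1 \<le> C3" and v: "norm v = 1"
    and g: "\<And>Q. \<exists>E a h. test Q v C3 C4 E a h \<and> (\<forall>R. \<not> bad L v E R \<longrightarrow> g R \<le> 16 * h R)"
    and Q: "near (1 / (16 * L)) S Q"
  shows "psum (near (1 / (16 * L)) S) g n Q \<le> 16 * C4 * (128 * C3 * D * K) * m Q"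
  using Q
proof (induction n arbitrary: Q rule: less_induct)
  case (less n)
  define \<kappa> where "\<kappa> = 16 * C4 * (128 * C3 * D * K)"
  let ?near = "near (1 / (16 * L)) S"
  obtain E a h where T: "test Q v C3 C4 E a h" and gh: "\<And>R. \<not> bad L v E R \<Longrightarrow> g R \<le> 16 * h R"
    using g by blast
  define P where "P R \<longleftrightarrow> ?near R \<and> \<not> bad L v E R" for R
  define f where "f R = (if ?near R then m R else 0)" for R
  have h: "\<And>R. 0 \<le> h R" "\<And>n. psum (\<lambda>_. True) h n Q \<le> C4 * m Q"
    using T unfolding test_def by blast+
  have C4: "0 \<le> C4"
    using h(1)[of Q] h(2)[of 0] m_pos[of Q] by (simp add: zero_le_mult_iff) (smt (verit) mult_neg_pos)
  have PQ: "P Q" using less.prems test_not_bad[OF T L] by (simp add: P_def)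
  \<comment> \<open>Only \<open>Q\<close> itself is treated at full depth \<open>n\<close>, and it
    is not stopped; so the outer induction hypothesis applies at every stopped cube.\<close>
  have decomp: "psum ?near g k R \<le> psum P g k R + \<kappa> * bsum P f k R" if "k < n \<or> R = Q \<and> k = n" for k R
    using that
  proof (induction k arbitrary: R)
    case 0
    then show ?case
    proof (cases "P R")
      case False
      then have "0 < n" if "?near R" using 0 PQ that by auto
      then have "?near R \<Longrightarrow> psum ?near g 0 R \<le> \<kappa> * m R"
        using less.IH[of 0 R] by (simp add: \<kappa>_def)
      then show ?thesis using False by (auto simp: f_def)
    qed (auto simp: P_def)
  next
    case (Suc k)
    show ?case
    proof (cases "P R")
      case True
      have "(\<Sum>R'\<in>ch R. psum ?near g k R') \<le> (\<Sum>R'\<in>ch R. psum P g k R' + \<kappa> * bsum P f k R')"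
        using Suc by (intro sum_mono) auto
      moreover have "?near R" using True by (simp add: P_def)
      ultimately show ?thesis
        using True by (simp add: sum.distrib sum_distrib_left)
    next
      case False
      then have "Suc k < n" if "?near R" using Suc.prems PQ that by auto
      then have "?near R \<Longrightarrow> psum ?near g (Suc k) R \<le> \<kappa> * m R"
        using less.IH[of "Suc k" R] by (simp add: \<kappa>_def del: psum.simps)
      moreover have "\<not> ?near R \<Longrightarrow> psum ?near g (Suc k) R = 0" by (rule psum_not)
      ultimately show ?thesis using False
        by (auto simp: f_def psum_not[of P] bsum_not[of P] simp del: psum.simps bsum.simps)
    qed
  qed
  have "psum P g n Q \<le> psum (\<lambda>_. True) (\<lambda>R. 16 * h R) n Q"
    by (rule psum_mono) (use gh h in \<open>auto simp: P_def\<close>)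
  also have "\<dots> \<le> 16 * (C4 * m Q)"
    unfolding psum_scale using h(2) by simp
  finally have 1: "psum P g n Q \<le> 16 * C4 * m Q" by simp
  have "bsum P f n Q \<le> (1 - 1 / (128 * C3 * D * K)) * m Q"
    unfolding P_def f_def by (rule stopped_mass[OF T L v less.prems])
  moreover have "0 \<le> \<kappa>" using C4 L D_ge_1 K_ge_1 by (simp add: \<kappa>_def)
  ultimately have "\<kappa> * bsum P f n Q \<le> \<kappa> * ((1 - 1 / (128 * C3 * D * K)) * m Q)"
    by (rule mult_left_mono)
  also have "\<dots> = \<kappa> * m Q - 16 * C4 * m Q"
    using L D_ge_1 K_ge_1 by (simp add: \<kappa>_def field_simps)
  finally have "psum P g n Q + \<kappa> * bsum P f n Q \<le> \<kappa> * m Q" using 1 by linarith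
  then show ?case using decomp[of n Q] by (simp add: \<kappa>_def)
qed

text \<open>The Bellman function \<open>ln det (B - A\<^sup>2 / 2)\<close>: since \<open>B - A\<^sup>2 / 2\<close> is operator concave in
  \<open>(A, B)\<close>, it is concave along the tree, and a change of \<open>A\<close> from \<open>S\<close> to \<open>R\<close> produces the gain
  \<open>tr (Dm S\<^sup>-\<^sup>1 (A R - A S)\<^sup>2) / 2\<close>.\<close>

definition Dm :: "'q \<Rightarrow> real^'N^'N" where
  "Dm Q = B Q - (1/2) *\<^sub>R (A Q ** A Q)"

definition \<Psi> :: "'q \<Rightarrow> real" where
  "\<Psi> Q = ln (det (Dm Q))"

lemma inner_A_A: "u \<bullet> ((A Q ** A Q) *v u) = (norm (A Q *v u))\<^sup>2"
  using symmetric_matrix_inner[OF A_sym, of Q u "A Q *v u"]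
  by (simp add: matrix_vector_mul_assoc[symmetric] dot_square_norm)

lemma inner_Dm: "u \<bullet> (Dm Q *v u) = u \<bullet> (B Q *v u) - (norm (A Q *v u))\<^sup>2 / 2"
  by (simp add: Dm_def matrix_vector_mult_diff_rdistrib inner_diff_right
      scaleR_matrix_vector_assoc[symmetric] inner_A_A)

lemma Dm_sym: "transpose (Dm Q) = Dm Q"
proof -
  have "transpose (A Q ** A Q) = A Q ** A Q" by (simp add: matrix_transpose_mul A_sym)
  then show ?thesis by (simp add: Dm_def transpose_diff transpose_scalar B_sym)
qed

lemma Dm_pd: "positive_definite (Dm Q)"
  unfolding positive_definite_def
proof (intro conjI allI impI Dm_sym)
  fix u :: "real^'N" assume "u \<noteq> 0"
  then have "0 < (norm (A Q *v u))\<^sup>2" using A_eq_0 by auto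
  then show "0 < u \<bullet> (Dm Q *v u)" using A_le_B[of Q u] unfolding inner_Dm by linarith
qed

text \<open>Monotonicity of \<open>ln det\<close> under \<open>Dm <= B\<close>, read off from the
  tangent plane at \<open>B\<close>.\<close>

lemma \<Psi>_le: "\<Psi> Q \<le> ln (det (B Q))"
proof -
  have BQ: "trace (matrix_inv (B Q) ** B Q) = CARD('N)"
    by (rule trace_inv_self) (rule B_pd)
  have "0 \<le> trace (matrix_inv (B Q) ** (B Q - Dm Q))"
    by (rule trace_inv_mult_nonneg[OF B_pd])
      (auto simp: transpose_diff B_sym Dm_sym matrix_vector_mult_diff_rdistrib inner_diff_right inner_Dm)
  then have "trace (matrix_inv (B Q) ** Dm Q) \<le> CARD('N)"
    by (simp add: matrix_diff_ldistrib trace_sub BQ)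
  then show ?thesis
    using ln_det_le_ln_det_plus_trace[OF B_pd[of Q] Dm_pd[of Q]] by (simp add: \<Psi>_def)
qed

text \<open>\<open>A^2 <= B\<close> gives \<open>B <= 2 Dm\<close>. The tangent plane at
  \<open>Dm\<close> turns the factor 2 into the loss \<open>2 N - N\<close>, with \<open>N\<close>
  the dimension.\<close>

lemma le_\<Psi>: "ln (det (B Q)) - CARD('N) \<le> \<Psi> Q"
proof -
  have DQ: "trace (matrix_inv (Dm Q) ** Dm Q) = CARD('N)"
    by (rule trace_inv_self) (rule Dm_pd)
  have "0 \<le> trace (matrix_inv (Dm Q) ** (Dm Q + Dm Q - B Q))"
  proof (rule trace_inv_mult_nonneg[OF Dm_pd])
    show "transpose (Dm Q + Dm Q - B Q) = Dm Q + Dm Q - B Q"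
      using Dm_sym[of Q] B_sym[of Q] by (simp add: transpose_def vec_eq_iff)
    show "0 \<le> u \<bullet> ((Dm Q + Dm Q - B Q) *v u)" for u
      using A_le_B[of Q u] unfolding matrix_vector_mult_diff_rdistrib
        matrix_vector_mult_add_rdistrib inner_diff_right inner_add_right inner_Dm by simp
  qed
  then have "trace (matrix_inv (Dm Q) ** B Q) \<le> 2 * CARD('N)"
    unfolding matrix_diff_ldistrib matrix_add_ldistrib trace_add trace_sub DQ by simp
  then show ?thesis
    using ln_det_le_ln_det_plus_trace[OF Dm_pd[of Q] B_pd[of Q]] by (simp add: \<Psi>_def)
qed

text \<open>The differential at \<open>(B S, A S)\<close> of \<open>ln det (B - A^2/2)\<close>; the
  symmetrised product is the derivative of the square of a noncommuting variable.\<close>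

definition lin :: "'q \<Rightarrow> real^'N^'N \<Rightarrow> real^'N^'N \<Rightarrow> real" where
  "lin S X Y = trace (matrix_inv (Dm S) ** (X - (1/2) *\<^sub>R (Y ** A S + A S ** Y)))"

lemma linear_lin: "linear (\<lambda>(X, Y). lin S X Y)"
proof (rule linearI, goal_cases)
  case (1 p q)
  then show ?case
    by (cases p; cases q)
      (simp add: lin_def matrix_diff_ldistrib matrix_add_ldistrib matrix_plus_rdistrib trace_add trace_sub
        scaleR_add_right)
next
  case (2 r p)
  have "matrix_inv (Dm S) ** (r *\<^sub>R X - (1/2) *\<^sub>R ((r *\<^sub>R Y) ** A S + A S ** (r *\<^sub>R Y)))
    = r *\<^sub>R (matrix_inv (Dm S) ** (X - (1/2) *\<^sub>R (Y ** A S + A S ** Y)))" for X Y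
    by (simp add: scalar_matrix_assoc[symmetric] matrix_scalar_ac matrix_diff_ldistrib
        matrix_add_ldistrib algebra_simps)
  moreover have "trace (r *\<^sub>R X) = r * trace X" for X :: "real^'N^'N"
    by (simp add: trace_def sum_distrib_left)
  ultimately show ?case
    by (cases p) (simp add: lin_def)
qed

lemma lin_children: "(\<Sum>R\<in>ch Q. m R * lin S (B R) (A R)) = m Q * lin S (B Q) (A Q)"
proof -
  have "(\<Sum>R\<in>ch Q. m R * lin S (B R) (A R)) = (\<Sum>R\<in>ch Q. (case m R *\<^sub>R (B R, A R) of (X, Y) \<Rightarrow> lin S X Y))"
    by (subst linear_scale[OF linear_lin]) simp
  also have "\<dots> = (case (\<Sum>R\<in>ch Q. m R *\<^sub>R (B R, A R)) of (X, Y) \<Rightarrow> lin S X Y)"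
    by (simp only: linear_sum[OF linear_lin])
  also have "(\<Sum>R\<in>ch Q. m R *\<^sub>R (B R, A R)) = m Q *\<^sub>R (B Q, A Q)"
    by (simp add: prod_eq_iff fst_sum snd_sum A_children B_children)
  also have "(case m Q *\<^sub>R (B Q, A Q) of (X, Y) \<Rightarrow> lin S X Y) = m Q * lin S (B Q) (A Q)"
    by (subst linear_scale[OF linear_lin]) simp
  finally show ?thesis .
qed

text \<open>The tangent plane of the Bellman function at \<open>S\<close>, evaluated at
  \<open>R\<close>. Being affine in \<open>(B, A)\<close>, it is compatible with averaging over
  children, for which \<open>\<Psi>\<close> satisfies only an inequality.\<close>

definition tangent :: "'q \<Rightarrow> 'q \<Rightarrow> real" where
  "tangent S R = \<Psi> S + lin S (B R) (A R) - lin S (B S) (A S)"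

lemma tangent_children: "(\<Sum>R\<in>ch Q. m R * tangent S R) = m Q * tangent S Q"
proof -
  have "(\<Sum>R\<in>ch Q. m R * tangent S R)
    = (\<Sum>R\<in>ch Q. m R * lin S (B R) (A R) + m R * (\<Psi> S - lin S (B S) (A S)))"
    by (simp add: tangent_def algebra_simps)
  also have "\<dots> = m Q * tangent S Q"
    by (simp add: sum.distrib lin_children sum_distrib_right[symmetric] m_children)
      (simp add: tangent_def algebra_simps)
  finally show ?thesis .
qed

lemma tangent_self: "tangent S S = \<Psi> S"
  by (simp add: tangent_def)

lemma \<Psi>_le_tangent_gain:
  "\<Psi> R \<le> tangent S R - trace (matrix_inv (Dm S) ** ((A R - A S) ** (A R - A S))) / 2"
proof -
  let ?M = "matrix_inv (Dm S)"
  have DD: "trace (?M ** Dm S) = CARD('N)"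
    by (rule trace_inv_self) (rule Dm_pd)
  \<comment> \<open>\<open>A R\<close> is expanded around \<open>A S\<close>: everything except the
    final square is affine in \<open>(B R, A R)\<close>, and that square is the gain.\<close>
  have eq: "Dm R = Dm S + ((B R - (1/2) *\<^sub>R (A R ** A S + A S ** A R))
      - (B S - (1/2) *\<^sub>R (A S ** A S + A S ** A S)))
      - (1/2) *\<^sub>R ((A R - A S) ** (A R - A S))"
    by (simp add: Dm_def matrix_diff_ldistrib matrix_diff_rdistrib algebra_simps)
  have "trace (?M ** ((1/2) *\<^sub>R X)) = trace (?M ** X) / 2" for X
    by (simp add: matrix_scalar_ac trace_def scalar_matrix_assoc[symmetric] sum_divide_distrib)
  then have "trace (?M ** Dm R) = CARD('N) + (lin S (B R) (A R) - lin S (B S) (A S))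
      - trace (?M ** ((A R - A S) ** (A R - A S))) / 2"
    by (subst eq) (simp only: lin_def matrix_diff_ldistrib[of ?M] matrix_add_ldistrib[of ?M] trace_sub trace_add DD)
  then show ?thesis
    using ln_det_le_ln_det_plus_trace[OF Dm_pd[of S] Dm_pd[of R]] by (simp add: \<Psi>_def tangent_def)
qed

lemma \<Psi>_le_tangent: "\<Psi> R \<le> tangent S R"
proof -
  have sym: "transpose (A R - A S) = A R - A S" by (simp add: transpose_diff A_sym)
  have "0 \<le> trace (matrix_inv (Dm S) ** ((A R - A S) ** (A R - A S)))"
  proof (rule trace_inv_mult_nonneg[OF Dm_pd])
    show "transpose ((A R - A S) ** (A R - A S)) = (A R - A S) ** (A R - A S)"
      by (simp add: matrix_transpose_mul sym)
    show "0 \<le> u \<bullet> (((A R - A S) ** (A R - A S)) *v u)" for u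
      using symmetric_matrix_inner[OF sym, of u "(A R - A S) *v u"]
      by (simp add: matrix_vector_mul_assoc[symmetric]) (metis inner_ge_zero)
  qed
  then show ?thesis using \<Psi>_le_tangent_gain[of R S] by linarith
qed

text \<open>At a vector \<open>u\<close> violating \<open>near\<close>, the change of
  \<open>A\<close> is bounded by the gain trace times the form of \<open>Dm S\<close>, and the
  reverse Hoelder inequality bounds that form by
  \<open>K * (norm (A S *v u))\<^sup>2\<close>.\<close>

lemma \<Psi>_le_tangent_not_near:
  assumes "\<not> near \<delta> S R" "0 \<le> \<delta>"
  shows "\<Psi> R \<le> tangent S R - \<delta>\<^sup>2 / (2 * K)"
proof -
  let ?Z = "A R - A S"
  let ?t = "trace (matrix_inv (Dm S) ** (?Z ** ?Z))"
  have sym: "transpose ?Z = ?Z" by (simp add: transpose_diff A_sym)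
  obtain u where u: "\<delta> * norm (A S *v u) < norm (?Z *v u)"
    using assms by (auto simp: near_def matrix_vector_mult_diff_rdistrib not_le)
  then have "A S *v u \<noteq> 0"
    using A_eq_0[of S u] by auto
  then have pos: "0 < (norm (A S *v u))\<^sup>2" by simp
  have uD: "0 \<le> u \<bullet> (Dm S *v u)" "u \<bullet> (Dm S *v u) \<le> K * (norm (A S *v u))\<^sup>2"
    using A_le_B[of S u] B_le_A[of u S] pos unfolding inner_Dm by linarith+
  have "(\<delta> * norm (A S *v u))\<^sup>2 \<le> (norm (?Z *v u))\<^sup>2"
    using u assms by (intro power_mono) auto
  also have "\<dots> \<le> ?t * (u \<bullet> (Dm S *v u))"
    by (rule norm_mult_le_trace_inv[OF Dm_pd sym])
  finally have 1: "\<delta>\<^sup>2 * (norm (A S *v u))\<^sup>2 \<le> ?t * (u \<bullet> (Dm S *v u))"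
    by (simp add: power_mult_distrib)
  have "0 \<le> ?t"
  proof (rule ccontr)
    assume "\<not> 0 \<le> ?t"
    moreover have "0 < (norm (?Z *v u))\<^sup>2"
      using u assms by (smt (verit) mult_nonneg_nonneg norm_ge_zero zero_less_power)
    moreover have "(norm (?Z *v u))\<^sup>2 \<le> ?t * (u \<bullet> (Dm S *v u))"
      by (rule norm_mult_le_trace_inv[OF Dm_pd sym])
    ultimately show False using uD(1) by (smt (verit) mult_nonneg_nonneg mult_minus_left)
  qed
  then have "?t * (u \<bullet> (Dm S *v u)) \<le> ?t * (K * (norm (A S *v u))\<^sup>2)"
    using uD by (intro mult_left_mono) auto
  with 1 have "\<delta>\<^sup>2 * (norm (A S *v u))\<^sup>2 \<le> (?t * K) * (norm (A S *v u))\<^sup>2"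
    by (simp add: mult_ac)
  then have "\<delta>\<^sup>2 \<le> ?t * K" using pos by simp
  then have "\<delta>\<^sup>2 / (2 * K) \<le> ?t / 2" using K_ge_1 by (simp add: field_simps)
  then show ?thesis using \<Psi>_le_tangent_gain[of R S] by linarith
qed

text \<open>\<open>m * \<Psi>\<close> minus an additive lower bound is a nonnegative potential.
  Inside the corona of \<open>S\<close>, \<open>\<Psi>\<close> is replaced by the tangent plane at
  \<open>S\<close>. A cube leaving the corona releases at least \<open>\<delta>^2 / (2 K)\<close>
  per unit mass, which \<open>\<rho>\<close> converts into \<open>\<kappa>\<close>, the price of a
  new corona.\<close>

lemma packing_bound:
  fixes \<kappa> \<delta> :: real
  assumes corona: "\<And>S n. psum (near \<delta> S) g n S \<le> \<kappa> * m S" and pos: "0 < \<delta>" "0 \<le> \<kappa>"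
  defines "\<rho> \<equiv> 2 * K * \<kappa> / \<delta>\<^sup>2"
  shows "psum (\<lambda>_. True) g n S \<le> \<kappa> * m S + \<rho> * (m S * \<Psi> S - (J S - CARD('N) * m S))"
proof (induction n arbitrary: S rule: less_induct)
  case (less n)
  \<comment> \<open>Additive because \<open>J\<close> is an integral, and below
    \<open>m R * \<Psi> R\<close> by \<open>J_le\<close> and \<open>le_\<Psi>\<close>.\<close>
  define low where "low R = J R - CARD('N) * m R" for R
  have low_children: "(\<Sum>R\<in>ch Q. low R) = low Q" for Q
    by (simp add: low_def sum_subtractf J_children sum_distrib_left[symmetric] m_children)
  have low: "low R \<le> m R * \<Psi> R" for R
  proof -
    have "m R * (ln (det (B R)) - CARD('N)) \<le> m R * \<Psi> R"
      using le_\<Psi>[of R] m_pos[of R] by (intro mult_left_mono) auto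
    then show ?thesis using J_le[of R] by (simp add: low_def algebra_simps)
  qed
  have l: "0 \<le> \<rho>" "\<rho> * (\<delta>\<^sup>2 / (2 * K)) = \<kappa>"
    using pos K_ge_1 by (auto simp: \<rho>_def)
  \<comment> \<open>At \<open>R = S\<close> the tangent plane equals \<open>\<Psi> S\<close>, so
    this yields the assertion; full depth occurs only there, and \<open>S\<close> is near
    itself.\<close>
  have "psum (\<lambda>_. True) g k R \<le> psum (near \<delta> S) g k R + \<rho> * (m R * tangent S R - low R)"
    if "k < n \<or> R = S \<and> k = n" for k R
    using that
  proof (induction k arbitrary: R)
    case 0
    show ?case
    proof (cases "near \<delta> S R")
      case True
      have "low R \<le> m R * tangent S R"
        using low[of R] \<Psi>_le_tangent[of R S] m_pos[of R] by (meson mult_left_mono less_imp_le order_trans)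
      then show ?thesis using True l by simp
    next
      case False
      then have "0 < n" using 0 near_refl[of \<delta> S] pos by auto
      then have "psum (\<lambda>_. True) g 0 R \<le> \<kappa> * m R + \<rho> * (m R * \<Psi> R - low R)"
        using less.IH[of 0 R] by (simp add: low_def)
      also have "\<dots> = \<rho> * (m R * (\<Psi> R + \<delta>\<^sup>2 / (2 * K)) - low R)"
        by (subst l(2)[symmetric]) (simp add: algebra_simps)
      also have "\<dots> \<le> \<rho> * (m R * tangent S R - low R)"
        using \<Psi>_le_tangent_not_near[OF False] pos l m_pos[of R]
        by (intro mult_left_mono diff_right_mono) auto
      finally show ?thesis using False by simp
    qed
  next
    case (Suc k)
    show ?case
    proof (cases "near \<delta> S R")
      case True
      have "(\<Sum>R'\<in>ch R. psum (\<lambda>_. True) g k R')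
        \<le> (\<Sum>R'\<in>ch R. psum (near \<delta> S) g k R' + \<rho> * (m R' * tangent S R' - low R'))"
        using Suc by (intro sum_mono) auto
      also have "\<dots> = (\<Sum>R'\<in>ch R. psum (near \<delta> S) g k R') + \<rho> * (m R * tangent S R - low R)"
        by (simp add: sum.distrib sum_distrib_left[symmetric] sum_subtractf tangent_children low_children)
      finally show ?thesis using True by simp
    next
      case False
      then have "Suc k < n" using Suc.prems near_refl[of \<delta> S] pos by auto
      then have "psum (\<lambda>_. True) g (Suc k) R \<le> \<kappa> * m R + \<rho> * (m R * \<Psi> R - low R)"
        using less.IH[of "Suc k" R] by (simp add: low_def del: psum.simps)
      also have "\<dots> = \<rho> * (m R * (\<Psi> R + \<delta>\<^sup>2 / (2 * K)) - low R)"
        by (subst l(2)[symmetric]) (simp add: algebra_simps)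
      also have "\<dots> \<le> \<rho> * (m R * tangent S R - low R)"
        using \<Psi>_le_tangent_not_near[OF False] pos l m_pos[of R]
        by (intro mult_left_mono diff_right_mono) auto
      finally show ?thesis using psum_not[of "near \<delta> S" R g "Suc k"] False by (simp del: psum.simps)
    qed
  qed
  from this[of n S] show ?case
    using corona[of S n] by (simp add: tangent_self low_def)
qed

theorem tree_bound:
  fixes L C3 C4 :: real
  assumes L: "128 * C3\<^sup>2 * D * K\<^sup>2 \<le> L\<^sup>2" "1 \<le> L" "1 \<le> C3" and v: "norm v = 1" and C4: "0 \<le> C4"
    and g: "\<And>Q. \<exists>E a h. test Q v C3 C4 E a h \<and> (\<forall>R. \<not> bad L v E R \<longrightarrow> g R \<le> 16 * h R)"
  shows "\<exists>C. \<forall>n Q. psum (\<lambda>_. True) g n Q \<le> C * m Q"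
proof -
  define \<kappa> where "\<kappa> = 16 * C4 * (128 * C3 * D * K)"
  define \<delta> where "\<delta> = 1 / (16 * L)"
  define \<rho> where "\<rho> = 2 * K * \<kappa> / \<delta>\<^sup>2"
  have pos: "0 < \<delta>" "0 \<le> \<kappa>" "0 \<le> \<rho>"
    using L C4 D_ge_1 K_ge_1 by (auto simp: \<kappa>_def \<delta>_def \<rho>_def)
  have "psum (near \<delta> S) g n S \<le> \<kappa> * m S" for S n
    unfolding \<kappa>_def \<delta>_def by (rule corona_bound[OF L v g near_refl]) (use L in simp)
  then have bound: "psum (\<lambda>_. True) g n S \<le> \<kappa> * m S + \<rho> * (m S * \<Psi> S - (J S - CARD('N) * m S))" for n S
    unfolding \<rho>_def using pos by (intro packing_bound)
  have "psum (\<lambda>_. True) g n S \<le> (\<kappa> + \<rho> * (c + CARD('N))) * m S" for n S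
  proof -
    have "m S * \<Psi> S \<le> m S * ln (det (B S))"
      using \<Psi>_le[of S] m_pos[of S] by (intro mult_left_mono) auto
    \<comment> \<open>The initial potential is controlled by the determinant condition, in the form
      \<open>le_J\<close>.\<close>
    then have "m S * \<Psi> S - (J S - CARD('N) * m S) \<le> (c + CARD('N)) * m S"
      using le_J[of S] by (simp add: algebra_simps)
    then have "\<rho> * (m S * \<Psi> S - (J S - CARD('N) * m S)) \<le> \<rho> * ((c + CARD('N)) * m S)"
      using pos by (intro mult_left_mono) auto
    then show ?thesis using bound[of n S] by (simp add: algebra_simps)
  qed
  then show ?thesis by blast
qed

end

section \<open>Dyadic cubes and Carleson boxes\<close>

text \<open>Cubes enter the tree through indices, scale exponent and lattice point: children become
  explicit and countability is immediate.\<close>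

definition dcube :: "int \<times> (int^'n) \<Rightarrow> (real^'n) set" where
  "dcube q = cube (\<chi> i. 2 powi fst q * of_int (snd q $ i)) (2 powi fst q)"

lemma dyadic_cubes_eq: "dyadic_cubes = range dcube"
  by (force simp: dyadic_cubes_def dcube_def image_def)

lemma sidelength_dcube: "sidelength (dcube q) = 2 powi fst q"
  by (simp add: dcube_def sidelength_cube)

lemma dcube_in_cubes: "dcube q \<in> cubes"
  unfolding dcube_def cubes_def by force

lemma mem_dcube_iff: "x \<in> dcube q \<longleftrightarrow> (\<forall>i. \<lfloor>x $ i / 2 powi fst q\<rfloor> = snd q $ i)"
proof -
  have "l * of_int z \<le> y \<and> y < l * of_int z + l \<longleftrightarrow> \<lfloor>y / l\<rfloor> = z" if "0 < l" for l y :: real and z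
    using that floor_eq_iff[of "y / l" z] by (auto simp: field_simps)
  from this[of "2 powi fst q"] show ?thesis
    by (simp add: dcube_def cube_def)
qed

text \<open>\<open>I\<close> is the set of coordinates in which the child takes the upper
  half.\<close>

definition children :: "int \<times> (int^'n) \<Rightarrow> (int \<times> (int^'n)) set" where
  "children q = (\<lambda>I. (fst q - 1, \<chi> i. 2 * snd q $ i + (if i \<in> I then 1 else 0))) ` UNIV"

lemma finite_children_dyadic: "finite (children q)"
  by (simp add: children_def)

lemma fst_children: "r \<in> children q \<Longrightarrow> fst r = fst q - 1"
  by (auto simp: children_def)

lemma powi_pred: "(2::real) powi (k - 1) = 2 powi k / 2"
  by (simp add: power_int_diff)

lemma dcube_disjoint:
  assumes "fst q = fst r" "q \<noteq> r"
  shows "dcube q \<inter> dcube r = {}"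
proof (rule ccontr)
  assume "dcube q \<inter> dcube r \<noteq> {}"
  then have "snd q = snd r" using assms(1) by (auto simp: mem_dcube_iff vec_eq_iff)
  then show False using assms by (simp add: prod_eq_iff)
qed

lemma disjoint_children: "disjoint_family_on dcube (children q)"
  unfolding disjoint_family_on_def using dcube_disjoint fst_children by metis

lemma dcube_children: "dcube q = (\<Union>r\<in>children q. dcube r)"
proof (intro equalityI subsetI)
  fix x assume x: "x \<in> dcube q"
  let ?I = "{i. odd \<lfloor>x $ i / 2 powi (fst q - 1)\<rfloor>}"
  have "\<lfloor>x $ i / 2 powi (fst q - 1)\<rfloor> = 2 * snd q $ i + (if i \<in> ?I then 1 else 0)" for i
  proof -
    define y where "y = x $ i / 2 powi fst q"
    have "\<lfloor>y\<rfloor> = snd q $ i" using x by (simp add: mem_dcube_iff y_def)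
    moreover have y2: "x $ i / 2 powi (fst q - 1) = 2 * y" by (simp add: y_def powi_pred)
    moreover have "\<lfloor>2 * y\<rfloor> = 2 * \<lfloor>y\<rfloor> \<or> \<lfloor>2 * y\<rfloor> = 2 * \<lfloor>y\<rfloor> + 1" by linarith
    ultimately show ?thesis by (auto simp: y2)
  qed
  then have "x \<in> dcube (fst q - 1, \<chi> i. 2 * snd q $ i + (if i \<in> ?I then 1 else 0))"
    by (simp add: mem_dcube_iff)
  then show "x \<in> (\<Union>r\<in>children q. dcube r)" unfolding children_def by blast
next
  fix x assume "x \<in> (\<Union>r\<in>children q. dcube r)"
  then obtain I where x: "x \<in> dcube (fst q - 1, \<chi> i. 2 * snd q $ i + (if i \<in> I then 1 else 0))"
    by (auto simp: children_def)
  have "\<lfloor>x $ i / 2 powi fst q\<rfloor> = snd q $ i" for i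
  proof -
    have "\<lfloor>x $ i / 2 powi (fst q - 1)\<rfloor> = 2 * snd q $ i + (if i \<in> I then 1 else 0)"
      using x by (simp add: mem_dcube_iff)
    then have "\<lfloor>2 * (x $ i / 2 powi fst q)\<rfloor> = 2 * snd q $ i + (if i \<in> I then 1 else 0)"
      by (simp add: powi_pred mult.commute)
    then show ?thesis by (auto split: if_splits) linarith+
  qed
  then show "x \<in> dcube q" by (simp add: mem_dcube_iff)
qed

lemma cube_borel: "cube a l \<in> sets borel"
proof -
  have "cube a l = {x. \<forall>i\<in>UNIV. a $ i \<le> x $ i} \<inter> {x. \<forall>i\<in>UNIV. x $ i < a $ i + l}"
    by (auto simp: cube_def)
  moreover have "closed {x. \<forall>i\<in>UNIV. a $ i \<le> x $ i}"
    by (simp add: closed_interval_right_cart)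
  moreover have "open {x. \<forall>i\<in>UNIV. x $ i < a $ i + l}"
  proof -
    have "{x. \<forall>i\<in>UNIV. x $ i < a $ i + l} = (\<Inter>i\<in>UNIV. {x. x $ i < a $ i + l})" by auto
    then show ?thesis by (auto intro!: open_INT open_Collect_less continuous_intros)
  qed
  ultimately show ?thesis by auto
qed

lemma dcube_borel: "dcube q \<in> sets borel"
  unfolding dcube_def by (rule cube_borel)

lemma doubling_children:
  fixes \<mu> :: "(real^'n) measure"
  assumes d: "doubling C \<mu>" and sets: "sets borel \<subseteq> sets \<mu>" and r: "r \<in> children q"
  shows "measure \<mu> (dcube q) \<le> C\<^sup>2 * measure \<mu> (dcube r)"
proof -
  let ?k = "fst q"
  define l where "l = (2::real) powi (?k - 1)"
  have l: "0 < l" "2 powi ?k = 2 * l" by (simp_all add: l_def powi_pred)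
  obtain I where rI: "r = (?k - 1, \<chi> i. 2 * snd q $ i + (if i \<in> I then 1 else 0))"
    using r by (auto simp: children_def)
  define a where "a = (\<chi> i. l * of_int (snd r $ i))"
  have rc: "dcube r = cube a l" by (simp add: dcube_def a_def l_def rI)
  \<comment> \<open>Two concentric doublings of the child lead to the cube of side
    \<open>4 * l\<close> with corner \<open>a - 3 l / 2\<close>, which contains the parent wherever
    the child sits in it.\<close>
  define a1 where "a1 = (\<chi> i. a $ i - l / 2)"
  define a2 where "a2 = (\<chi> i. a1 $ i - (2 * l) / 2)"
  have step: "measure \<mu> (cube (\<chi> i. a $ i - l / 2) (2 * l)) \<le> C * measure \<mu> (cube a l)"
    if "0 < l" for a l
    using d that unfolding doubling_def by blast
  have fin: "emeasure \<mu> (cube a l) < \<infinity>" if "0 < l" for a l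
    using d that unfolding doubling_def cubes_def by blast
  have sub: "dcube q \<subseteq> cube a2 (4 * l)"
  proof
    fix x assume "x \<in> dcube q"
    then have x: "2 * l * of_int (snd q $ i) \<le> x $ i" "x $ i < 2 * l * of_int (snd q $ i) + 2 * l" for i
      by (auto simp: dcube_def cube_def l(2))
    have a2: "a2 $ i = 2 * l * of_int (snd q $ i) + (if i \<in> I then l else 0) - 3 * l / 2" for i
      by (simp add: a2_def a1_def a_def rI algebra_simps)
    have "a2 $ i \<le> x $ i \<and> x $ i < a2 $ i + 4 * l" for i
      using x[of i] l(1) unfolding a2 by (cases "i \<in> I") auto
    then show "x \<in> cube a2 (4 * l)" by (simp add: cube_def)
  qed
  have "0 < measure \<mu> (cube a l)"
    using d l(1) unfolding doubling_def cubes_def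
    by (metis (mono_tags, lifting) emeasure_eq_ennreal_measure enn2real_positive_iff measure_def
        mem_Collect_eq infinity_ennreal_def)
  moreover have "0 \<le> C * measure \<mu> (cube a l)"
    using step[OF l(1), of a] measure_nonneg order_trans by blast
  ultimately have C: "0 \<le> C" by (simp add: zero_le_mult_iff)
  have "measure \<mu> (dcube q) \<le> measure \<mu> (cube a2 (4 * l))"
    using sub subsetD[OF sets cube_borel] subsetD[OF sets dcube_borel] fin[of "4 * l" a2] l(1)
    by (intro measure_mono_fmeasurable) (auto simp: fmeasurable_def)
  also have "\<dots> \<le> C * measure \<mu> (cube a1 (2 * l))"
    using step[of "2 * l" a1] l(1) by (simp add: a2_def)
  also have "\<dots> \<le> C * (C * measure \<mu> (cube a l))"
    using step[OF l(1), of a] C unfolding a1_def by (intro mult_left_mono)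
  finally show ?thesis by (simp add: rc power2_eq_square mult_ac)
qed

text \<open>A Carleson box truncated from below. The height interval is closed above so that
  \<open>n = 0\<close> gives exactly the points at which \<open>dyadic_at\<close> selects this
  cube.\<close>

definition treebox :: "int \<times> (int^'n) \<Rightarrow> nat \<Rightarrow> (real \<times> (real^'n)) set" where
  "treebox q n = {2 powi (fst q - 1 - int n) <.. 2 powi fst q} \<times> dcube q"

lemma treebox_borel: "treebox q n \<in> sets borel"
  unfolding treebox_def borel_prod[symmetric] by (intro pair_measureI) (auto simp: dcube_borel)

lemma powi_less_iff: "(2::real) powi a < 2 powi b \<longleftrightarrow> a < b"
  using power_int_strict_increasing[of a b "2::real"] power_int_increasing[of b a "2::real"]
  by (meson not_le one_less_numeral_iff numeral_le_one_iff semiring_norm less_imp_le one_le_numeral)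

lemma treebox_Suc: "treebox q (Suc n) = treebox q 0 \<union> (\<Union>r\<in>children q. treebox r n)"
proof -
  have 1: "{2 powi (fst q - 1 - int (Suc n)) <.. (2::real) powi fst q}
    = {2 powi (fst q - 1) <.. 2 powi fst q} \<union> {2 powi (fst q - 1 - 1 - int n) <.. 2 powi (fst q - 1)}"
  proof -
    have "(2::real) powi (fst q - 1) \<le> 2 powi fst q" by (simp add: powi_pred)
    moreover have "(2::real) powi (fst q - 1 - int (Suc n)) \<le> 2 powi (fst q - 1)"
      by (intro power_int_increasing) auto
    moreover have "fst q - 1 - 1 - int n = fst q - 1 - int (Suc n)" by simp
    moreover have "{a<..c} = {b<..c} \<union> {a<..b}" if "a \<le> b" "b \<le> c" for a b c :: real
      using that by auto
    ultimately show ?thesis by metis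
  qed
  have 2: "(\<Union>r\<in>children q. treebox r n)
      = {2 powi (fst q - 1 - 1 - int n) <.. 2 powi (fst q - 1)} \<times> dcube q"
    unfolding dcube_children[of q] treebox_def using fst_children by fastforce
  show ?thesis
    unfolding 2 unfolding treebox_def 1 by auto
qed

lemma treebox_disjoint:
  "disjoint_family_on (\<lambda>r. treebox r n) (children q)"
  "treebox q 0 \<inter> (\<Union>r\<in>children q. treebox r n) = {}"
proof -
  show "disjoint_family_on (\<lambda>r. treebox r n) (children q)"
    using disjoint_children[of q] unfolding disjoint_family_on_def treebox_def by blast
  show "treebox q 0 \<inter> (\<Union>r\<in>children q. treebox r n) = {}"
    using fst_children[of _ q] by (force simp: treebox_def)
qed

lemma carleson_box_subset: "carleson_box (dcube q) \<subseteq> (\<Union>n. treebox q n)"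
proof
  fix p assume "p \<in> carleson_box (dcube q)"
  then obtain t x where p: "p = (t, x)" "0 < t" "t < 2 powi fst q" "x \<in> dcube q"
    by (auto simp: carleson_box_def sidelength_dcube)
  have "0 < t / 2 powi fst q" using p by simp
  then obtain n where "(1/2) ^ n < t / 2 powi fst q"
    using real_arch_pow_inv[of "t / 2 powi fst q" "1/2"] by auto
  then have "2 powi fst q * (1/2) ^ n < t" by (simp add: field_simps)
  moreover have "(2::real) powi (fst q - 1 - int n) \<le> 2 powi fst q * (1/2) ^ n"
    by (simp add: power_int_diff power_int_add power_one_over field_simps)
  ultimately have "p \<in> treebox q n" using p by (auto simp: treebox_def)
  then show "p \<in> (\<Union>n. treebox q n)" by blast
qed

lemma incseq_treebox: "incseq (treebox q)"
proof (rule incseq_SucI)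
  fix n
  have "(2::real) powi (fst q - 1 - int (Suc n)) \<le> 2 powi (fst q - 1 - int n)"
    by (intro power_int_increasing) auto
  then show "treebox q n \<subseteq> treebox q (Suc n)" by (auto simp: treebox_def)
qed

lemma dyadic_at_treebox:
  assumes "(t, x) \<in> treebox q 0"
  shows "dyadic_at t x = dcube q"
proof -
  have t: "2 powi (fst q - 1) < t" "t \<le> 2 powi fst q" "x \<in> dcube q"
    using assms by (auto simp: treebox_def)
  have "(0::real) < 2 powi (fst q - 1)" by simp
  then have "0 < t" using t(1) by (rule order_less_trans)
  show ?thesis
    unfolding dyadic_at_def
    by (rule the1_equality[OF dyadic_at_ex1[OF \<open>0 < t\<close>]])
      (use t in \<open>auto simp: dyadic_cubes_eq sidelength_dcube\<close>)
qed

lemma UN_treebox: "(\<Union>q. treebox q 0) = {0<..} \<times> (UNIV :: (real^'n) set)"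
proof (intro equalityI subsetI)
  fix p :: "real \<times> (real^'n)" assume "p \<in> {0<..} \<times> UNIV"
  then obtain t x where p: "p = (t, x)" "0 < t" by auto
  obtain Q k where Q: "Q \<in> dyadic_cubes" "x \<in> Q" "sidelength Q = 2 powi k" "2 powi (k - 1) < t" "t \<le> 2 powi k"
    using dyadic_at_ex1[OF p(2), of x] by blast
  then obtain q where q: "Q = dcube q" by (auto simp: dyadic_cubes_eq)
  then have "(2::real) powi fst q = 2 powi k" using Q by (simp add: sidelength_dcube)
  then have "fst q = k" using powi_less_iff[of "fst q" k] powi_less_iff[of k "fst q"] by simp
  then have "p \<in> treebox q 0" using Q p q by (simp add: treebox_def)
  then show "p \<in> (\<Union>q. treebox q 0)" by blast
next
  fix p :: "real \<times> (real^'n)" assume "p \<in> (\<Union>q. treebox q 0)"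
  then obtain q where "p \<in> treebox q 0" by blast
  moreover have "(0::real) < 2 powi (fst q - 1)" by simp
  ultimately show "p \<in> {0<..} \<times> UNIV"
    using order_less_trans[of 0 "2 powi (fst q - 1)" "fst p"] by (auto simp: treebox_def)
qed

text \<open>The recursion that defines \<open>psum\<close>, for integrals over boxes.\<close>

lemma nn_integral_treebox_Suc:
  fixes f :: "real \<times> (real^'n) \<Rightarrow> ennreal"
  assumes f: "f \<in> borel_measurable M" and M: "\<And>q n. treebox q n \<in> sets M"
  shows "(\<integral>\<^sup>+p\<in>treebox q (Suc n). f p \<partial>M)
    = (\<integral>\<^sup>+p\<in>treebox q 0. f p \<partial>M) + (\<Sum>r\<in>children q. \<integral>\<^sup>+p\<in>treebox r n. f p \<partial>M)"
proof -
  have "(\<integral>\<^sup>+p\<in>treebox q (Suc n). f p \<partial>M)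
    = (\<integral>\<^sup>+p. f p * indicator (treebox q 0) p + (\<Sum>r\<in>children q. f p * indicator (treebox r n) p) \<partial>M)"
  proof (rule nn_integral_cong)
    fix p
    have "(indicator (\<Union>r\<in>children q. treebox r n) p :: ennreal) = (\<Sum>r\<in>children q. indicator (treebox r n) p)"
      by (rule indicator_UN_disjoint[OF finite_children_dyadic treebox_disjoint(1)])
    moreover have "(indicator (treebox q (Suc n)) p :: ennreal)
        = indicator (treebox q 0) p + indicator (\<Union>r\<in>children q. treebox r n) p"
      unfolding treebox_Suc using treebox_disjoint(2)[of q n] by (auto simp: indicator_def)
    ultimately show "f p * indicator (treebox q (Suc n)) p
        = f p * indicator (treebox q 0) p + (\<Sum>r\<in>children q. f p * indicator (treebox r n) p)"
      by (simp add: distrib_left sum_distrib_left)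
  qed
  also have "\<dots> = (\<integral>\<^sup>+p\<in>treebox q 0. f p \<partial>M) + (\<Sum>r\<in>children q. \<integral>\<^sup>+p\<in>treebox r n. f p \<partial>M)"
    using f M by (subst nn_integral_add) (auto intro!: borel_measurable_sum simp: nn_integral_sum)
  finally show ?thesis .
qed

text \<open>Removes the truncation: a bound uniform in the depth survives monotone
  convergence.\<close>

lemma nn_integral_carleson_box_le:
  fixes f :: "real \<times> (real^'n) \<Rightarrow> ennreal"
  assumes f: "f \<in> borel_measurable M" and M: "\<And>n. treebox q n \<in> sets M"
    and le: "\<And>n. (\<integral>\<^sup>+p\<in>treebox q n. f p \<partial>M) \<le> c"
  shows "(\<integral>\<^sup>+p\<in>carleson_box (dcube q). f p \<partial>M) \<le> c"
proof -
  have "(\<integral>\<^sup>+p\<in>carleson_box (dcube q). f p \<partial>M) \<le> (\<integral>\<^sup>+p\<in>(\<Union>n. treebox q n). f p \<partial>M)"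
    using carleson_box_subset[of q] by (intro nn_integral_mono) (auto simp: indicator_def)
  also have "\<dots> = (SUP n. \<integral>\<^sup>+p\<in>treebox q n. f p \<partial>M)"
  proof -
    have "(\<Union>n. treebox q n) \<in> sets M" using M by auto
    then show ?thesis
      using SUP_emeasure_incseq[of "treebox q" "density M f"] incseq_treebox[of q] M f
      by (simp add: emeasure_density image_subset_iff)
  qed
  also have "\<dots> \<le> c" using le by (rule SUP_least)
  finally show ?thesis .
qed

section \<open>Averages of the weight\<close>

lemma set_integral_linear:
  fixes T :: "'a::euclidean_space \<Rightarrow> 'b::euclidean_space"
  assumes "linear T" "set_integrable M S f"
  shows "set_integrable M S (\<lambda>x. T (f x))" "(LINT x:S|M. T (f x)) = T (LINT x:S|M. f x)"
proof -
  have T: "bounded_linear T" using assms(1) by (simp add: linear_conv_bounded_linear)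
  have eq: "indicator S x *\<^sub>R T (f x) = T (indicator S x *\<^sub>R f x)" for x
    by (simp add: linear_scale[OF assms(1)])
  show "set_integrable M S (\<lambda>x. T (f x))"
    using integrable_bounded_linear[OF T] assms(2) unfolding set_integrable_def eq by blast
  show "(LINT x:S|M. T (f x)) = T (LINT x:S|M. f x)"
    using integral_bounded_linear[OF T] assms(2)
    unfolding set_integrable_def set_lebesgue_integral_def eq by blast
qed

lemma set_integral_pos:
  fixes f :: "'a \<Rightarrow> real"
  assumes f: "set_integrable M S f" and S: "S \<in> sets M" "0 < emeasure M S"
    and pos: "AE x in M. 0 < f x"
  shows "0 < (LINT x:S|M. f x)"
proof -
  let ?g = "\<lambda>x. indicator S x *\<^sub>R f x"
  have nonneg: "AE x in M. 0 \<le> ?g x"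
    using pos by eventually_elim (auto simp: indicator_def)
  have "integral\<^sup>L M ?g \<noteq> 0"
  proof
    assume "integral\<^sup>L M ?g = 0"
    then have "AE x in M. ?g x = 0"
      using integral_nonneg_eq_0_iff_AE[OF f[unfolded set_integrable_def] nonneg] by simp
    with pos have "AE x in M. x \<notin> S"
      by eventually_elim (auto simp: indicator_def split: if_splits)
    moreover have "{x \<in> space M. \<not> x \<notin> S} = S"
      using sets.sets_into_space[OF S(1)] by auto
    ultimately show False
      using S AE_iff_measurable[OF S(1), of "\<lambda>x. x \<notin> S"] by simp
  qed
  moreover have "0 \<le> integral\<^sup>L M ?g" using nonneg by (rule integral_nonneg_AE)
  ultimately show ?thesis by (simp add: set_lebesgue_integral_def)
qed

lemma set_integral_eq_AE:
  fixes f g :: "'a \<Rightarrow> real"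
  assumes "set_integrable M S f" "set_integrable M S g" "AE x in M. f x = g x"
  shows "(LINT x:S|M. f x) = (LINT x:S|M. g x)"
  by (rule antisym; rule set_integral_mono_AE) (use assms in \<open>auto elim: eventually_mono\<close>)

lemma linear_inner_mult: "linear (\<lambda>X :: real^'n^'m. u \<bullet> (X *v v))"
  by (rule linearI) (auto simp: matrix_vector_mult_add_rdistrib inner_add_right
      scaleR_matrix_vector_assoc[symmetric])

lemma linear_trace_mult: "linear (\<lambda>X :: real^'n^'n. trace (M ** X))"
proof (rule linearI)
  show "trace (M ** (X + Y)) = trace (M ** X) + trace (M ** Y)" for X Y :: "real^'n^'n"
    by (simp add: matrix_add_ldistrib trace_add)
  show "trace (M ** (r *\<^sub>R X)) = r *\<^sub>R trace (M ** X)" for r and X :: "real^'n^'n"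
    by (simp add: matrix_scalar_ac trace_def scalar_matrix_assoc[symmetric] sum_distrib_left)
qed

lemma bounded_bilinear_matrix_vector_mult:
  "bounded_bilinear ((*v) :: real^'n^'m \<Rightarrow> real^'n \<Rightarrow> real^'m)"
proof
  show "\<exists>K. \<forall>(A::real^'n^'m) x. norm (A *v x) \<le> norm A * norm x * K"
    using norm_matrix_vector_mult_le by (metis mult.right_neutral)
qed (simp_all add: matrix_vector_mult_add_rdistrib matrix_vector_right_distrib
      scaleR_matrix_vector_assoc matrix_vector_mult_scaleR)

lemma borel_measurable_matrix_vector_mult:
  fixes f :: "'a \<Rightarrow> real^'n^'m"
  assumes "f \<in> borel_measurable M" "g \<in> borel_measurable M"
  shows "(\<lambda>x. f x *v g x) \<in> borel_measurable M"
  by (rule borel_measurable_continuous_Pair[OF assms])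
    (intro bounded_bilinear.continuous_on[OF bounded_bilinear_matrix_vector_mult] continuous_intros)

section \<open>Dyadic averages of the matrix weight\<close>

locale matrix_weight =
  fixes w :: "real^'n \<Rightarrow> real" and \<mu> :: "(real^'n) measure" and W :: "real^'n \<Rightarrow> real^'N^'N"
    and C1 C2 :: real
  assumes w_meas: "w \<in> borel_measurable lebesgue"
    and mu: "\<mu> = weighted_measure w"
    and doubling: "doubling C1 \<mu>"
    and W_meas: "W \<in> borel_measurable lebesgue"
    and W_pos: "AE x in lebesgue. positive_definite (W x)"
    and W_int: "\<And>Q. Q \<in> cubes \<Longrightarrow> set_integrable \<mu> Q W"
    and W2_int: "\<And>Q. Q \<in> cubes \<Longrightarrow> set_integrable \<mu> Q (\<lambda>x. W x ** W x)"
    and W_det: "\<And>Q. Q \<in> cubes \<Longrightarrow>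
      det (average \<mu> Q (\<lambda>x. W x ** W x)) \<le> C2\<^sup>2 * geometric_mean \<mu> Q (\<lambda>x. det (W x ** W x))"
begin

definition mass :: "int \<times> (int^'n) \<Rightarrow> real" where "mass q = measure \<mu> (dcube q)"
definition avgW :: "int \<times> (int^'n) \<Rightarrow> real^'N^'N" where "avgW q = average \<mu> (dcube q) W"
definition avgW2 :: "int \<times> (int^'n) \<Rightarrow> real^'N^'N" where
  "avgW2 q = average \<mu> (dcube q) (\<lambda>x. W x ** W x)"
definition lndet :: "int \<times> (int^'n) \<Rightarrow> real" where
  "lndet q = (LINT x:dcube q|\<mu>. ln (det (W x ** W x)))"

lemma sets_mu: "sets \<mu> = sets lebesgue"
  by (simp add: mu weighted_measure_def)

lemma borel_sets_mu: "sets borel \<subseteq> sets \<mu>"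
  using sets_completionI_sub[of _ lborel] by (auto simp: sets_mu)

lemma dcube_sets: "dcube q \<in> sets \<mu>"
  using borel_sets_mu dcube_borel by blast

lemma measurable_mu: "borel_measurable \<mu> = borel_measurable lebesgue"
  by (rule measurable_cong_sets) (simp_all add: sets_mu)

lemma AE_mu: "AE x in \<mu>. positive_definite (W x)"
  using W_pos w_meas unfolding mu weighted_measure_def
  by (subst AE_density) (auto elim: eventually_mono)

lemma emeasure_dcube: "0 < emeasure \<mu> (dcube q)" "emeasure \<mu> (dcube q) < \<infinity>"
  using doubling dcube_in_cubes unfolding doubling_def by blast+

lemma emeasure_dcube_eq: "emeasure \<mu> (dcube q) = ennreal (mass q)"
  using emeasure_dcube[of q] by (simp add: mass_def emeasure_eq_ennreal_measure less_top)

lemma mass_pos: "0 < mass q"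
  using emeasure_dcube(1)[of q] by (simp add: emeasure_dcube_eq)

lemma set_integrable_const: "set_integrable \<mu> (dcube q) (\<lambda>_. c :: real)"
  using emeasure_dcube[of q] dcube_sets by (simp add: set_integrable_def)

lemma set_integral_constant: "(LINT x:dcube q|\<mu>. (c :: real)) = mass q * c"
  using emeasure_dcube[of q] dcube_sets by (simp add: set_lebesgue_integral_def mass_def)

lemma set_integral_children:
  fixes f :: "real^'n \<Rightarrow> 'b :: {banach, second_countable_topology}"
  assumes "\<And>q. set_integrable \<mu> (dcube q) f"
  shows "(\<Sum>r\<in>children q. LINT x:dcube r|\<mu>. f x) = (LINT x:dcube q|\<mu>. f x)"
  unfolding dcube_children[of q]
  by (rule set_integral_finite_Union[symmetric])
    (auto simp: assms dcube_sets finite_children_dyadic disjoint_children)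

lemma int_W: "set_integrable \<mu> (dcube q) W"
  using W_int dcube_in_cubes by blast

lemma int_W2: "set_integrable \<mu> (dcube q) (\<lambda>x. W x ** W x)"
  using W2_int dcube_in_cubes by blast

lemma mass_avgW: "mass q *\<^sub>R avgW q = (LINT x:dcube q|\<mu>. W x)"
  using mass_pos[of q] by (simp add: avgW_def average_def mass_def)

lemma mass_avgW2: "mass q *\<^sub>R avgW2 q = (LINT x:dcube q|\<mu>. W x ** W x)"
  using mass_pos[of q] by (simp add: avgW2_def average_def mass_def)

lemma linear_W:
  fixes T :: "real^'N^'N \<Rightarrow> real"
  assumes "linear T"
  shows "set_integrable \<mu> (dcube q) (\<lambda>x. T (W x))" "(LINT x:dcube q|\<mu>. T (W x)) = mass q * T (avgW q)"
  using set_integral_linear[OF assms int_W[of q]] linear_scale[OF assms, of "mass q" "avgW q"]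
  by (simp_all add: mass_avgW)

lemma linear_W2:
  fixes T :: "real^'N^'N \<Rightarrow> real"
  assumes "linear T"
  shows "set_integrable \<mu> (dcube q) (\<lambda>x. T (W x ** W x))"
    "(LINT x:dcube q|\<mu>. T (W x ** W x)) = mass q * T (avgW2 q)"
  using set_integral_linear[OF assms int_W2[of q]] linear_scale[OF assms, of "mass q" "avgW2 q"]
  by (simp_all add: mass_avgW2)

lemma avgW_pd: "positive_definite (avgW q)"
  unfolding positive_definite_def
proof (intro conjI allI impI)
  show "transpose (avgW q) = avgW q"
  proof (rule symmetric_matrixI)
    fix u v
    have "AE x in \<mu>. u \<bullet> (W x *v v) = v \<bullet> (W x *v u)"
      using AE_mu
    proof eventually_elim
      case (elim x)
      then have "transpose (W x) = W x" by (simp add: positive_definite_def)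
      then show ?case using symmetric_matrix_inner[of "W x" u v] by (simp add: inner_commute)
    qed
    then have "mass q * (u \<bullet> (avgW q *v v)) = mass q * (v \<bullet> (avgW q *v u))"
      using set_integral_eq_AE[OF linear_W(1)[OF linear_inner_mult] linear_W(1)[OF linear_inner_mult]]
      by (simp add: linear_W(2)[OF linear_inner_mult])
    then show "u \<bullet> (avgW q *v v) = v \<bullet> (avgW q *v u)" using mass_pos[of q] by simp
  qed
  fix u :: "real^'N" assume "u \<noteq> 0"
  then have "AE x in \<mu>. 0 < u \<bullet> (W x *v u)"
    using AE_mu by (auto simp: positive_definite_def elim: eventually_mono)
  then have "0 < mass q * (u \<bullet> (avgW q *v u))"
    using set_integral_pos[OF linear_W(1)[OF linear_inner_mult] dcube_sets emeasure_dcube(1)]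
    by (simp add: linear_W(2)[OF linear_inner_mult])
  then show "0 < u \<bullet> (avgW q *v u)" using mass_pos[of q] by (simp add: zero_less_mult_iff)
qed

lemma avgW2_sym: "transpose (avgW2 q) = avgW2 q"
proof (rule symmetric_matrixI)
  fix u v
  have "AE x in \<mu>. u \<bullet> ((W x ** W x) *v v) = v \<bullet> ((W x ** W x) *v u)"
    using AE_mu
  proof eventually_elim
    case (elim x)
    then have "transpose (W x ** W x) = W x ** W x"
      using positive_definite_square(1)[OF elim] by (simp add: positive_definite_def)
    then show ?case using symmetric_matrix_inner[of "W x ** W x" u v] by (simp add: inner_commute)
  qed
  then have "mass q * (u \<bullet> (avgW2 q *v v)) = mass q * (v \<bullet> (avgW2 q *v u))"
    using set_integral_eq_AE[OF linear_W2(1)[OF linear_inner_mult] linear_W2(1)[OF linear_inner_mult]]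
    by (simp add: linear_W2(2)[OF linear_inner_mult])
  then show "u \<bullet> (avgW2 q *v v) = v \<bullet> (avgW2 q *v u)" using mass_pos[of q] by simp
qed

text \<open>Integrates \<open>|W u - y|^2 >= 0\<close>, where \<open>y\<close> is the average of
  \<open>W u\<close>.\<close>

lemma avgW_le_avgW2: "(norm (avgW q *v u))\<^sup>2 \<le> u \<bullet> (avgW2 q *v u)"
proof -
  define y where "y = avgW q *v u"
  let ?f = "\<lambda>x. u \<bullet> ((W x ** W x) *v u)" and ?g = "\<lambda>x. 2 * (y \<bullet> (W x *v u))"
  have f: "set_integrable \<mu> (dcube q) ?f" "(LINT x:dcube q|\<mu>. ?f x) = mass q * (u \<bullet> (avgW2 q *v u))"
    using linear_W2[OF linear_inner_mult] by auto
  have g: "set_integrable \<mu> (dcube q) ?g" "(LINT x:dcube q|\<mu>. ?g x) = mass q * (2 * (y \<bullet> y))"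
    using linear_W[OF linear_inner_mult[of y u], of q] by (simp_all add: y_def)
  have "AE x in \<mu>. ?g x \<le> ?f x + y \<bullet> y"
    using AE_mu
  proof eventually_elim
    case (elim x)
    have "0 \<le> (norm (W x *v u - y))\<^sup>2" by simp
    also have "\<dots> = (norm (W x *v u))\<^sup>2 - 2 * (y \<bullet> (W x *v u)) + y \<bullet> y"
      unfolding dot_square_norm[symmetric] by (simp add: inner_diff_left inner_diff_right inner_commute)
    finally show ?case by (simp add: positive_definite_square(2)[OF elim])
  qed
  then have "(LINT x:dcube q|\<mu>. ?g x) \<le> (LINT x:dcube q|\<mu>. ?f x + y \<bullet> y)"
    by (intro set_integral_mono_AE g set_integral_add f set_integrable_const) auto
  also have "\<dots> = mass q * (u \<bullet> (avgW2 q *v u)) + mass q * (y \<bullet> y)"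
    by (subst set_integral_add(2)[OF f(1) set_integrable_const]) (simp add: f(2) set_integral_constant)
  finally have "mass q * (y \<bullet> y) \<le> mass q * (u \<bullet> (avgW2 q *v u))"
    unfolding g(2) by (simp add: algebra_simps)
  then show ?thesis using mass_pos[of q] by (simp add: y_def dot_square_norm)
qed

lemma avgW2_pd: "positive_definite (avgW2 q)"
  unfolding positive_definite_def
proof (intro conjI allI impI avgW2_sym)
  fix u :: "real^'N" assume "u \<noteq> 0"
  then have "avgW q *v u \<noteq> 0"
    using avgW_pd[of q] by (fastforce simp: positive_definite_def)
  then have "0 < (norm (avgW q *v u))\<^sup>2" by simp
  then show "0 < u \<bullet> (avgW2 q *v u)" using avgW_le_avgW2[of q u] by linarith
qed

text \<open>If \<open>ln det W^2\<close> were not integrable, \<open>geometric_mean\<close> would be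
  0 and the determinant condition would contradict the positivity of
  \<open>det (avgW2 q)\<close>.\<close>

lemma int_lndet: "set_integrable \<mu> (dcube q) (\<lambda>x. ln (det (W x ** W x)))"
  and det_avgW2_le: "det (avgW2 q) \<le> C2\<^sup>2 * exp (lndet q / mass q)"
proof -
  have le: "det (avgW2 q) \<le> C2\<^sup>2 * geometric_mean \<mu> (dcube q) (\<lambda>x. det (W x ** W x))"
    unfolding avgW2_def by (rule W_det[OF dcube_in_cubes])
  moreover have "0 < det (avgW2 q)" by (rule positive_definite_det_pos[OF avgW2_pd])
  ultimately have "geometric_mean \<mu> (dcube q) (\<lambda>x. det (W x ** W x)) \<noteq> 0" by auto
  then show int: "set_integrable \<mu> (dcube q) (\<lambda>x. ln (det (W x ** W x)))"
    by (metis geometric_mean_def)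
  show "det (avgW2 q) \<le> C2\<^sup>2 * exp (lndet q / mass q)"
    using le int by (simp add: geometric_mean_def average_def lndet_def mass_def divide_inverse mult.commute)
qed

lemma C2_pos: "0 < C2\<^sup>2"
proof (rule ccontr)
  assume "\<not> 0 < C2\<^sup>2"
  then have "C2\<^sup>2 = 0" by (simp add: not_less)
  then show False
    using det_avgW2_le[of undefined] positive_definite_det_pos[OF avgW2_pd[of undefined]] by simp
qed

text \<open>Jensen: the tangent plane of \<open>ln det\<close> at the average is integrated over the
  cube.\<close>

lemma lndet_le_avgW2: "lndet q \<le> mass q * ln (det (avgW2 q))"
proof -
  let ?B = "avgW2 q"
  let ?c = "ln (det ?B) - CARD('N)"
  let ?f = "\<lambda>x. trace (matrix_inv ?B ** (W x ** W x))"
  have "AE x in \<mu>. ln (det (W x ** W x)) \<le> ?f x + ?c"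
    using AE_mu
  proof eventually_elim
    case (elim x)
    then show ?case
      using ln_det_le_ln_det_plus_trace[OF avgW2_pd[of q] positive_definite_square(1)[of "W x"]] by linarith
  qed
  then have "lndet q \<le> (LINT x:dcube q|\<mu>. ?f x + ?c)"
    unfolding lndet_def
    by (intro set_integral_mono_AE int_lndet set_integral_add set_integrable_const linear_W2(1) linear_trace_mult) auto
  also have "\<dots> = mass q * trace (matrix_inv ?B ** ?B) + mass q * ?c"
    by (subst set_integral_add(2)[OF linear_W2(1)[OF linear_trace_mult] set_integrable_const])
      (simp only: linear_W2(2)[OF linear_trace_mult] set_integral_constant)
  finally show ?thesis
    by (simp add: trace_inv_self avgW2_pd algebra_simps)
qed

text \<open>Jensen for \<open>W\<close> itself. Combined with the determinant condition it bounds
  \<open>det (avgW2 q)\<close> by \<open>C2\<^sup>2 * (det (avgW q))\<^sup>2\<close>.\<close>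

lemma lndet_le_avgW: "lndet q \<le> mass q * (2 * ln (det (avgW q)))"
proof -
  let ?A = "avgW q"
  let ?c = "2 * ln (det ?A) - 2 * CARD('N)"
  let ?f = "\<lambda>x. 2 * trace (matrix_inv ?A ** W x)"
  have f: "set_integrable \<mu> (dcube q) ?f" "(LINT x:dcube q|\<mu>. ?f x) = mass q * (2 * trace (matrix_inv ?A ** ?A))"
    using linear_W[OF linear_trace_mult, of q "matrix_inv ?A"] by simp_all
  have "AE x in \<mu>. ln (det (W x ** W x)) \<le> ?f x + ?c"
    using AE_mu
  proof eventually_elim
    case (elim x)
    have "ln (det (W x ** W x)) = 2 * ln (det (W x))"
      using positive_definite_square(5)[OF elim] by (simp add: det_mul ln_mult)
    then show ?case
      using ln_det_le_ln_det_plus_trace[OF avgW_pd[of q] elim] by linarith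
  qed
  then have "lndet q \<le> (LINT x:dcube q|\<mu>. ?f x + ?c)"
    unfolding lndet_def
    by (intro set_integral_mono_AE int_lndet set_integral_add set_integrable_const f) auto
  also have "\<dots> = mass q * (2 * trace (matrix_inv ?A ** ?A)) + mass q * ?c"
    by (subst set_integral_add(2)[OF f(1) set_integrable_const]) (simp only: f(2) set_integral_constant)
  finally show ?thesis
    by (simp add: trace_inv_self avgW_pd algebra_simps)
qed

lemma avgW2_le_avgW: "u \<bullet> (avgW2 q *v u) \<le> C2\<^sup>2 * (norm (avgW q *v u))\<^sup>2"
proof (rule quadratic_form_le_norm_of_det_le[OF avgW_pd avgW2_sym avgW_le_avgW2])
  have pos: "0 < det (avgW q)" by (rule positive_definite_det_pos[OF avgW_pd])
  have "lndet q / mass q \<le> 2 * ln (det (avgW q))"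
    using lndet_le_avgW[of q] mass_pos[of q] by (simp add: pos_divide_le_eq mult.commute)
  then have "exp (lndet q / mass q) \<le> exp (ln (det (avgW q))) ^ 2"
    by (simp add: exp_double[symmetric])
  then have "exp (lndet q / mass q) \<le> (det (avgW q))\<^sup>2" using pos by simp
  then show "det (avgW2 q) \<le> C2\<^sup>2 * (det (avgW q))\<^sup>2"
    using det_avgW2_le[of q] C2_pos by (meson mult_left_mono less_imp_le order_trans)
qed

lemma ln_det_avgW2_le: "mass q * ln (det (avgW2 q)) \<le> lndet q + ln (C2\<^sup>2) * mass q"
proof -
  have "ln (det (avgW2 q)) \<le> ln (C2\<^sup>2 * exp (lndet q / mass q))"
    using det_avgW2_le[of q] positive_definite_det_pos[OF avgW2_pd[of q]] C2_pos
    by (subst ln_le_cancel_iff) auto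
  also have "\<dots> = ln (C2\<^sup>2) + lndet q / mass q"
    using C2_pos by (subst ln_mult) auto
  finally show ?thesis
    using mass_pos[of q] mult_left_mono[of _ _ "mass q"] by (fastforce simp: algebra_simps)
qed

sublocale weighted_tree children mass avgW avgW2 lndet "max 1 (C1\<^sup>2)" "max 1 (C2\<^sup>2)" "ln (C2\<^sup>2)"
proof
  fix q r :: "int \<times> (int^'n)" and u :: "real^'N"
  show "0 < mass q" by (rule mass_pos)
  show "(\<Sum>R\<in>children q. mass R) = mass q"
    using set_integral_children[OF set_integrable_const[of _ 1], of q] by (simp add: set_integral_constant)
  show "mass q \<le> max 1 (C1\<^sup>2) * mass r" if "r \<in> children q"
  proof -
    have "mass q \<le> C1\<^sup>2 * mass r"
      unfolding mass_def by (rule doubling_children[OF doubling borel_sets_mu that])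
    also have "\<dots> \<le> max 1 (C1\<^sup>2) * mass r" using mass_pos[of r] by (intro mult_right_mono) auto
    finally show ?thesis .
  qed
  show "(\<Sum>R\<in>children q. mass R *\<^sub>R avgW R) = mass q *\<^sub>R avgW q"
    unfolding mass_avgW by (rule set_integral_children[OF int_W])
  show "(\<Sum>R\<in>children q. mass R *\<^sub>R avgW2 R) = mass q *\<^sub>R avgW2 q"
    unfolding mass_avgW2 by (rule set_integral_children[OF int_W2])
  show "(\<Sum>R\<in>children q. lndet R) = lndet q"
    unfolding lndet_def by (rule set_integral_children[OF int_lndet])
  show "u \<bullet> (avgW2 q *v u) \<le> max 1 (C2\<^sup>2) * (norm (avgW q *v u))\<^sup>2"
    using avgW2_le_avgW[of u q] by (rule order_trans) (intro mult_right_mono, auto)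
qed (auto intro: avgW_pd avgW2_sym avgW_le_avgW2 lndet_le_avgW2 ln_det_avgW2_le)

section \<open>Test functions as data on the tree\<close>

lemma int_norm2:
  assumes "f \<in> L2 \<mu>"
  shows "set_integrable \<mu> (dcube q) (\<lambda>x. (norm (f x))\<^sup>2)"
  using assms integrable_mult_indicator[OF dcube_sets[of q], of "\<lambda>x. (norm (f x))\<^sup>2"]
  by (simp add: L2_def set_integrable_def)

lemma int_W_mult:
  fixes f :: "real^'n \<Rightarrow> real^'N"
  assumes f: "f \<in> L2 \<mu>"
  shows "set_integrable \<mu> (dcube q) (\<lambda>x. W x *v f x)"
proof (rule set_integrable_bound)
  \<comment> \<open>The majorant is \<open>|W|^2 + |f|^2\<close>; the factor \<open>mat 1\<close>
    exhibits the first term as a linear functional of \<open>W^2\<close>.\<close>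
  show "set_integrable \<mu> (dcube q) (\<lambda>x. trace (mat 1 ** (W x ** W x)) + (norm (f x))\<^sup>2)"
    by (intro set_integral_add linear_W2(1) linear_trace_mult int_norm2 f)
  have "(\<lambda>x. W x *v f x) \<in> borel_measurable \<mu>"
    using f W_meas by (intro borel_measurable_matrix_vector_mult) (auto simp: L2_def measurable_mu)
  then show "set_borel_measurable \<mu> (dcube q) (\<lambda>x. W x *v f x)"
    unfolding set_borel_measurable_def using dcube_sets by (intro borel_measurable_scaleR) auto
  show "AE x in \<mu>. x \<in> dcube q \<longrightarrow>
      norm (W x *v f x) \<le> norm (trace (mat 1 ** (W x ** W x)) + (norm (f x))\<^sup>2)"
    using AE_mu
  proof eventually_elim
    case (elim x)
    have "norm (W x *v f x) \<le> norm (W x) * norm (f x)" by (rule norm_matrix_vector_mult_le)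
    also have "\<dots> \<le> (norm (W x))\<^sup>2 + (norm (f x))\<^sup>2"
      using sum_squares_bound[of "norm (W x)" "norm (f x)"]
        mult_nonneg_nonneg[OF norm_ge_zero[of "W x"] norm_ge_zero[of "f x"]] by linarith
    finally show ?case by (simp add: positive_definite_square(4)[OF elim])
  qed
qed

text \<open>Turns a weighted average into a plain integral, which is additive over children. The
  inverse is genuine because the integral of \<open>W\<close> is positive definite.\<close>

lemma mass_weighted_average:
  fixes f :: "real^'n \<Rightarrow> real^'N"
  shows "mass q *\<^sub>R (avgW q *v weighted_average \<mu> W (dcube q) f) = (LINT x:dcube q|\<mu>. W x *v f x)"
proof -
  have "positive_definite (mass q *\<^sub>R avgW q)"
    using avgW_pd[of q] mass_pos[of q]
    by (auto simp: positive_definite_def transpose_scalar scaleR_matrix_vector_assoc[symmetric])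
  from matrix_inv_mult_self(1)[OF positive_definite_invertible[OF this]]
  have "(mass q *\<^sub>R avgW q) *v (matrix_inv (mass q *\<^sub>R avgW q) *v y) = y" for y
    by (metis matrix_vector_mul_assoc matrix_vector_mul_lid)
  then show ?thesis
    unfolding weighted_average_def mass_avgW[symmetric] scaleR_matrix_vector_assoc .
qed

lemma test_function:
  fixes f :: "real^'n \<Rightarrow> real^'N"
  assumes f: "f \<in> L2 \<mu>" and v: "v \<bullet> weighted_average \<mu> W (dcube Q) f = 1"
    and bound: "(LINT x|\<mu>. (norm (f x))\<^sup>2) \<le> c3 * mass Q"
    and h: "\<And>r. 0 \<le> h r" "\<And>n. psum (\<lambda>_. True) h n Q \<le> c4 * mass Q"
  shows "test Q v c3 c4 (\<lambda>r. weighted_average \<mu> W (dcube r) f)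
    (\<lambda>r. LINT x:dcube r|\<mu>. (norm (f x))\<^sup>2) h"
  unfolding test_def
proof (intro conjI allI impI v h)
  show "(\<Sum>R\<in>children P. mass R *\<^sub>R (avgW R *v weighted_average \<mu> W (dcube R) f))
      = mass P *\<^sub>R (avgW P *v weighted_average \<mu> W (dcube P) f)" for P
    unfolding mass_weighted_average by (rule set_integral_children[OF int_W_mult[OF f]])
  show "0 \<le> (LINT x:dcube R|\<mu>. (norm (f x))\<^sup>2)" for R
    unfolding set_lebesgue_integral_def by (rule integral_nonneg_AE) auto
  show "(\<Sum>R\<in>children P. LINT x:dcube R|\<mu>. (norm (f x))\<^sup>2) \<le> (LINT x:dcube P|\<mu>. (norm (f x))\<^sup>2)" for P
    by (rule eq_refl) (rule set_integral_children[OF int_norm2[OF f]])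
  have "(LINT x:dcube Q|\<mu>. (norm (f x))\<^sup>2) \<le> (LINT x|\<mu>. (norm (f x))\<^sup>2)"
    using f int_norm2[OF f, of Q] unfolding set_lebesgue_integral_def set_integrable_def
    by (intro integral_mono) (auto simp: L2_def indicator_def)
  then show "(LINT x:dcube Q|\<mu>. (norm (f x))\<^sup>2) \<le> c3 * mass Q" using bound by simp
next
  fix R u and s :: real assume s: "0 < s"
  let ?f = "\<lambda>x. s / 2 * (u \<bullet> ((W x ** W x) *v u))" and ?g = "\<lambda>x. (norm (f x))\<^sup>2 / (2 * s)"
  have f1: "set_integrable \<mu> (dcube R) ?f"
    "(LINT x:dcube R|\<mu>. ?f x) = s / 2 * (mass R * (u \<bullet> (avgW2 R *v u)))"
  proof -
    have int: "set_integrable \<mu> (dcube R) (\<lambda>x. u \<bullet> ((W x ** W x) *v u))"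
      by (rule linear_W2(1)[OF linear_inner_mult])
    have "(LINT x:dcube R|\<mu>. u \<bullet> ((W x ** W x) *v u)) = mass R * (u \<bullet> (avgW2 R *v u))"
      by (rule linear_W2(2)[OF linear_inner_mult])
    then show "(LINT x:dcube R|\<mu>. ?f x) = s / 2 * (mass R * (u \<bullet> (avgW2 R *v u)))"
      by (subst set_integral_mult_right) (rule arg_cong)
    show "set_integrable \<mu> (dcube R) ?f" using int by simp
  qed
  have g1: "set_integrable \<mu> (dcube R) ?g" using int_norm2[OF f, of R] by simp
  have uWf: "set_integrable \<mu> (dcube R) (\<lambda>x. u \<bullet> (W x *v f x))"
    "(LINT x:dcube R|\<mu>. u \<bullet> (W x *v f x)) = u \<bullet> (LINT x:dcube R|\<mu>. W x *v f x)"
    using set_integral_linear[of "\<lambda>y. u \<bullet> y", OF _ int_W_mult[OF f, of R]]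
    by (auto simp: bounded_linear.linear[OF bounded_linear_inner_right])
  have "AE x in \<mu>. u \<bullet> (W x *v f x) \<le> ?f x + ?g x"
    using AE_mu
  proof eventually_elim
    case (elim x)
    define p where "p = norm (W x *v u)"
    define r where "r = norm (f x)"
    have "u \<bullet> (W x *v f x) = (W x *v u) \<bullet> f x" using positive_definite_square(3)[OF elim] by simp
    also have "\<dots> \<le> p * r" unfolding p_def r_def by (rule norm_cauchy_schwarz)
    also have "\<dots> \<le> s / 2 * p\<^sup>2 + r\<^sup>2 / (2 * s)"
    proof -
      have "0 \<le> (s * p - r)\<^sup>2 / (2 * s)" using s by simp
      also have "\<dots> = s / 2 * p\<^sup>2 + r\<^sup>2 / (2 * s) - p * r"
        using s by (simp add: field_simps power2_eq_square)
      finally show ?thesis by simp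
    qed
    finally show ?case by (simp add: positive_definite_square(2)[OF elim] p_def r_def)
  qed
  then have "(LINT x:dcube R|\<mu>. u \<bullet> (W x *v f x)) \<le> (LINT x:dcube R|\<mu>. ?f x + ?g x)"
    by (intro set_integral_mono_AE uWf set_integral_add f1 g1) auto
  also have "\<dots> = s / 2 * (mass R * (u \<bullet> (avgW2 R *v u))) + (LINT x:dcube R|\<mu>. (norm (f x))\<^sup>2) / (2 * s)"
    by (subst set_integral_add(2)[OF f1(1) g1]) (simp only: f1(2) set_integral_divide_zero)
  finally show "mass R * (u \<bullet> (avgW R *v weighted_average \<mu> W (dcube R) f))
      \<le> s / 2 * (mass R * (u \<bullet> (avgW2 R *v u))) + (LINT x:dcube R|\<mu>. (norm (f x))\<^sup>2) / (2 * s)"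
    unfolding uWf(2) mass_weighted_average[symmetric] by simp
qed

end

section \<open>The Carleson estimate\<close>

lemma space_halfspace: "space (halfspace_measure w) = {0<..} \<times> UNIV"
  by (simp add: halfspace_measure_def space_restrict_space)

lemma sets_halfspace: "sets (halfspace_measure w) = sets (lebesgue_on ({0<..} \<times> UNIV))"
  by (simp add: halfspace_measure_def)

lemma treebox_sets_halfspace: "treebox q n \<in> sets (halfspace_measure (w :: real^'n \<Rightarrow> real))"
proof -
  have "{0<..} \<times> UNIV \<in> sets (borel :: (real \<times> (real^'n)) measure)"
    unfolding borel_prod[symmetric] by (intro pair_measureI) auto
  moreover have "(0::real) < 2 powi (fst q - 1 - int n)" by simp
  then have "treebox q n \<subseteq> {0<..} \<times> UNIV"
    using order_less_trans[of 0 "(2::real) powi (fst q - 1 - int n)"] by (auto simp: treebox_def)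
  ultimately show ?thesis
    using treebox_borel[of q n] sets_completionI_sub[of _ lborel]
    unfolding sets_halfspace by (subst sets_restrict_space_iff) auto
qed

text \<open>The averages are constant on each \<open>treebox q 0\<close>, and countably many of
  these cover the half space.\<close>

lemma borel_measurable_averaged:
  fixes \<gamma> :: "real \<Rightarrow> real^'n \<Rightarrow> real^'N^'M"
  assumes g: "(\<lambda>(t, x). \<gamma> t x) \<in> borel_measurable (halfspace_measure w)"
  shows "(\<lambda>(t, x). ennreal ((norm (\<gamma> t x *v dyadic_averaging \<mu> W t f x))\<^sup>2))
    \<in> borel_measurable (halfspace_measure w)"
proof (rule measurable_piecewise_restrict[where C = "range (\<lambda>q. treebox q 0)"])
  fix \<Omega> :: "(real \<times> (real^'n)) set" assume "\<Omega> \<in> range (\<lambda>q. treebox q 0)"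
  then obtain q where q: "\<Omega> = treebox q 0" by blast
  show "\<Omega> \<inter> space (halfspace_measure w) \<in> sets (halfspace_measure w)"
    unfolding q using treebox_sets_halfspace by blast
  have "(\<lambda>p. ennreal ((norm ((case p of (t, x) \<Rightarrow> \<gamma> t x) *v weighted_average \<mu> W (dcube q) f))\<^sup>2))
      \<in> borel_measurable (restrict_space (halfspace_measure w) \<Omega>)"
    using borel_measurable_matrix_vector_mult[OF measurable_restrict_space1[OF g] borel_measurable_const]
    by measurable
  then show "(\<lambda>(t, x). ennreal ((norm (\<gamma> t x *v dyadic_averaging \<mu> W t f x))\<^sup>2))
      \<in> borel_measurable (restrict_space (halfspace_measure w) \<Omega>)"
    by (rule measurable_cong[THEN iffD1, rotated])
      (auto simp: space_restrict_space q dyadic_averaging_def dyadic_at_treebox)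
qed (auto simp: space_halfspace UN_treebox)

section \<open>Covering directions by finitely many cones\<close>

lemma finite_net_sphere:
  fixes e :: real
  assumes "0 < e"
  obtains V :: "(real^'N) set" where "finite V" "\<And>v. v \<in> V \<Longrightarrow> norm v = 1"
    "\<And>y. y \<noteq> 0 \<Longrightarrow> \<exists>v\<in>V. norm (y - norm y *\<^sub>R v) \<le> e * norm y"
proof -
  have "seq_compact (sphere (0 :: real^'N) 1)"
    using compact_imp_seq_compact compact_sphere by blast
  from seq_compact_imp_totally_bounded[rule_format, OF this assms]
  obtain V where V: "finite V" "V \<subseteq> sphere (0 :: real^'N) 1" "sphere 0 1 \<subseteq> (\<Union>v\<in>V. ball v e)"
    by (elim exE conjE) (rule that)
  have "\<exists>v\<in>V. norm (y - norm y *\<^sub>R v) \<le> e * norm y" if "y \<noteq> 0" for y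
  proof -
    have "y /\<^sub>R norm y \<in> sphere 0 1" using that by simp
    then obtain v where v: "v \<in> V" "dist v (y /\<^sub>R norm y) < e"
      using V(3) by (meson UN_E mem_ball subsetD)
    have "y - norm y *\<^sub>R v = norm y *\<^sub>R (y /\<^sub>R norm y - v)"
      using that by (simp add: scaleR_diff_right)
    then have "norm (y - norm y *\<^sub>R v) = norm y * norm (y /\<^sub>R norm y - v)" by simp
    also have "\<dots> \<le> norm y * e"
      using v(2) by (intro mult_left_mono) (auto simp: dist_norm norm_minus_commute)
    finally show ?thesis using v(1) by (auto simp: mult.commute)
  qed
  moreover have "norm v = 1" if "v \<in> V" for v
    using V(2) that by auto
  ultimately show thesis using that V(1) by blast
qed

text \<open>Meant for a row \<open>y\<close> of \<open>\<gamma>\<close> and an average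
  \<open>z\<close> on a cube that is not bad: the main part of \<open>y \<bullet> z\<close> is at
  least \<open>|y|/2\<close>, the deviation at most \<open>|y|/4\<close>. Squaring gives the
  16.\<close>

lemma cone_inner_bound:
  fixes y v z :: "'a::real_inner"
  assumes y: "norm (y - norm y *\<^sub>R v) \<le> 1 / (4 * L) * norm y" and z: "1/2 \<le> v \<bullet> z" "norm z \<le> L" and L: "0 < L"
  shows "(norm y)\<^sup>2 \<le> 16 * (y \<bullet> z)\<^sup>2"
proof -
  have "- (norm (y - norm y *\<^sub>R v) * norm z) \<le> (y - norm y *\<^sub>R v) \<bullet> z"
    using Cauchy_Schwarz_ineq2[of "y - norm y *\<^sub>R v" z] by (simp add: abs_le_iff)
  moreover have "norm (y - norm y *\<^sub>R v) * norm z \<le> (1 / (4 * L) * norm y) * L"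
    using y z L by (intro mult_mono) auto
  moreover have "(1 / (4 * L) * norm y) * L = norm y / 4" using L by simp
  moreover have "norm y * (1/2) \<le> norm y * (v \<bullet> z)" using z by (intro mult_left_mono) auto
  moreover have "y \<bullet> z = norm y * (v \<bullet> z) + (y - norm y *\<^sub>R v) \<bullet> z" by (simp add: inner_diff_left)
  ultimately have "norm y \<le> 4 * (y \<bullet> z)" by linarith
  then have "(norm y)\<^sup>2 \<le> (4 * (y \<bullet> z))\<^sup>2" by (intro power_mono) auto
  then show ?thesis by (simp add: power_mult_distrib)
qed

context matrix_weight
begin

text \<open>Finiteness matters because \<open>enn2real\<close> sends infinity to 0.\<close>

lemma psum_nn_integral:
  assumes f: "f \<in> borel_measurable (halfspace_measure u)"
    and fin: "\<And>q. (\<integral>\<^sup>+p\<in>treebox q 0. f p \<partial>halfspace_measure u) < \<infinity>"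
  shows "ennreal (psum (\<lambda>_. True) (\<lambda>q. enn2real (\<integral>\<^sup>+p\<in>treebox q 0. f p \<partial>halfspace_measure u)) n q)
    = (\<integral>\<^sup>+p\<in>treebox q n. f p \<partial>halfspace_measure u)"
proof -
  let ?g = "\<lambda>q. enn2real (\<integral>\<^sup>+p\<in>treebox q 0. f p \<partial>halfspace_measure u)"
  have nonneg: "0 \<le> psum (\<lambda>_. True) ?g n q" for n q
    by (induction n arbitrary: q) (simp_all add: sum_nonneg)
  have g: "ennreal (?g q) = (\<integral>\<^sup>+p\<in>treebox q 0. f p \<partial>halfspace_measure u)" for q
    using fin[of q] by (simp add: less_top)
  show ?thesis
  proof (induction n arbitrary: q)
    case 0
    show ?case using g by simp
  next
    case (Suc n)
    have "ennreal (psum (\<lambda>_. True) ?g (Suc n) q)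
        = ennreal (?g q) + (\<Sum>r\<in>children q. ennreal (psum (\<lambda>_. True) ?g n r))"
      using nonneg by (simp add: ennreal_plus sum_nonneg sum_ennreal del: ennreal_enn2real_if)
    also have "\<dots> = (\<integral>\<^sup>+p\<in>treebox q (Suc n). f p \<partial>halfspace_measure u)"
      unfolding Suc g nn_integral_treebox_Suc[OF f treebox_sets_halfspace] ..
    finally show ?case .
  qed
qed

text \<open>Of the form \<open>1 + X\<close> with \<open>X >= 0\<close>, so that its square
  dominates \<open>X\<close> without a square root.\<close>

definition threshold :: "real \<Rightarrow> real" where
  "threshold c3 = 1 + 128 * c3\<^sup>2 * max 1 (C1\<^sup>2) * (max 1 (C2\<^sup>2))\<^sup>2"

lemma threshold:
  "128 * c3\<^sup>2 * max 1 (C1\<^sup>2) * (max 1 (C2\<^sup>2))\<^sup>2 \<le> (threshold c3)\<^sup>2" "1 \<le> threshold c3"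
proof -
  define X where "X = 128 * c3\<^sup>2 * max 1 (C1\<^sup>2) * (max 1 (C2\<^sup>2))\<^sup>2"
  have "0 \<le> X" unfolding X_def by (intro mult_nonneg_nonneg) auto
  moreover have "threshold c3 = 1 + X" by (simp add: threshold_def X_def)
  moreover have "(1 + X)\<^sup>2 = 1 + 2 * X + X\<^sup>2" by (simp add: power2_eq_square algebra_simps)
  ultimately have "X \<le> (threshold c3)\<^sup>2" "1 \<le> threshold c3" by auto
  then show "128 * c3\<^sup>2 * max 1 (C1\<^sup>2) * (max 1 (C2\<^sup>2))\<^sup>2 \<le> (threshold c3)\<^sup>2" "1 \<le> threshold c3"
    by (simp_all add: X_def)
qed

text \<open>One row and one cone at a time, so that the tree argument can use a single direction
  \<open>v\<close>.\<close>

lemma cone_carleson_bound: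
  fixes \<gamma> :: "real \<Rightarrow> real^'n \<Rightarrow> real^'N^'M" and b :: "(real^'n) set \<Rightarrow> real^'n \<Rightarrow> real^'N"
    and i :: 'M and c3 C4 :: real
  defines "L \<equiv> threshold c3"
  assumes v: "norm v = 1" and c3: "1 \<le> c3"
    and gamma_meas: "(\<lambda>(t, x). \<gamma> t x) \<in> borel_measurable (halfspace_measure w)"
    and b_L2: "\<And>q. b (dcube q) \<in> L2 \<mu>"
    and b_avg: "\<And>q. v \<bullet> weighted_average \<mu> W (dcube q) (b (dcube q)) = 1"
    and b_bound: "\<And>q. (LINT x|\<mu>. (norm (b (dcube q) x))\<^sup>2) \<le> c3 * mass q"
    and b_carleson: "\<And>q. (\<integral>\<^sup>+(t, x). ennreal ((norm (\<gamma> t x *v dyadic_averaging \<mu> W t (b (dcube q)) x))\<^sup>2)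
        \<partial>halfspace_measure w) \<le> ennreal (C4\<^sup>2) * emeasure \<mu> (dcube q)"
  defines "G \<equiv> \<lambda>(t, x). ennreal ((norm (\<gamma> t x $ i))\<^sup>2) *
    indicator {y. norm (y - norm y *\<^sub>R v) \<le> 1 / (4 * L) * norm y} (\<gamma> t x $ i)"
  shows "G \<in> borel_measurable (halfspace_measure w)"
    and "\<exists>C\<ge>0. \<forall>n q. (\<integral>\<^sup>+p\<in>treebox q n. G p \<partial>halfspace_measure w) \<le> ennreal (C * mass q)"
proof -
  let ?H = "halfspace_measure w"
  have "closed {y :: real^'N. norm (y - norm y *\<^sub>R v) \<le> 1 / (4 * L) * norm y}"
    by (intro closed_Collect_le continuous_intros)
  then have cone: "{y :: real^'N. norm (y - norm y *\<^sub>R v) \<le> 1 / (4 * L) * norm y} \<in> sets borel"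
    by (rule borel_closed)
  have row: "(\<lambda>p. (case p of (t, x) \<Rightarrow> \<gamma> t x) $ i) \<in> borel_measurable ?H"
    by (rule measurable_compose[OF gamma_meas borel_measurable_continuous_onI]) (intro continuous_intros)
  have G_eq: "G = (\<lambda>p. ennreal ((norm ((case p of (t, x) \<Rightarrow> \<gamma> t x) $ i))\<^sup>2) *
      indicator {y. norm (y - norm y *\<^sub>R v) \<le> 1 / (4 * L) * norm y} ((case p of (t, x) \<Rightarrow> \<gamma> t x) $ i))"
    unfolding G_def by (auto simp: fun_eq_iff)
  show G: "G \<in> borel_measurable ?H"
    unfolding G_eq using row
    by (intro borel_measurable_times_ennreal measurable_compose[OF row borel_measurable_indicator[OF cone]]) simp
  define F where "F q = (\<lambda>(t, x). ennreal ((norm (\<gamma> t x *v dyadic_averaging \<mu> W t (b (dcube q)) x))\<^sup>2))" for q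
  have F: "F q \<in> borel_measurable ?H" for q
    unfolding F_def by (rule borel_measurable_averaged[OF gamma_meas])
  define E where "E q r = weighted_average \<mu> W (dcube r) (b (dcube q))" for q r
  have F_le: "(\<integral>\<^sup>+p\<in>treebox r n. F q p \<partial>?H) \<le> ennreal (C4\<^sup>2 * mass q)" for q r n
  proof -
    have "(\<integral>\<^sup>+p\<in>treebox r n. F q p \<partial>?H) \<le> (\<integral>\<^sup>+p. F q p \<partial>?H)"
      by (intro nn_integral_mono) (auto simp: indicator_def)
    also have "\<dots> \<le> ennreal (C4\<^sup>2) * emeasure \<mu> (dcube q)"
      unfolding F_def by (rule b_carleson)
    finally show ?thesis by (simp add: emeasure_dcube_eq ennreal_mult mass_pos less_imp_le)
  qed
  have F_fin: "(\<integral>\<^sup>+p\<in>treebox r n. F q p \<partial>?H) < \<infinity>" for q r n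
    using le_less_trans[OF F_le] by simp
  define h where "h q r = enn2real (\<integral>\<^sup>+p\<in>treebox r 0. F q p \<partial>?H)" for q r
  have T: "test q v c3 (C4\<^sup>2) (E q) (\<lambda>r. LINT x:dcube r|\<mu>. (norm (b (dcube q) x))\<^sup>2) (h q)" for q
    unfolding E_def
  proof (rule test_function[OF b_L2 b_avg b_bound])
    show "0 \<le> h q r" for r by (simp add: h_def)
    have "ennreal (psum (\<lambda>_. True) (h q) n q) \<le> ennreal (C4\<^sup>2 * mass q)" for n
      unfolding h_def psum_nn_integral[OF F F_fin] by (rule F_le)
    then show "psum (\<lambda>_. True) (h q) n q \<le> C4\<^sup>2 * mass q" for n
      using mass_pos[of q] by (simp add: ennreal_le_iff)
  qed
  have L: "128 * c3\<^sup>2 * max 1 (C1\<^sup>2) * (max 1 (C2\<^sup>2))\<^sup>2 \<le> L\<^sup>2" "1 \<le> L"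
    unfolding L_def by (rule threshold)+
  have G_le: "(\<integral>\<^sup>+p\<in>treebox r 0. G p \<partial>?H) \<le> 16 * (\<integral>\<^sup>+p\<in>treebox r 0. F q p \<partial>?H)"
    if "\<not> bad L v (E q) r" for q r
  proof -
    have E: "1/2 \<le> v \<bullet> E q r" "norm (E q r) \<le> L" using that by (auto simp: bad_def)
    have "G p * indicator (treebox r 0) p \<le> 16 * (F q p * indicator (treebox r 0) p)" for p
    proof (cases "p \<in> treebox r 0")
      case True
      obtain t x where p: "p = (t, x)" by fastforce
      have avg: "dyadic_averaging \<mu> W t (b (dcube q)) x = E q r"
        using dyadic_at_treebox[of t x r] True by (simp add: p dyadic_averaging_def E_def)
      have "G p \<le> ennreal (16 * (norm (\<gamma> t x *v E q r))\<^sup>2)"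
      proof (cases "norm (\<gamma> t x $ i - norm (\<gamma> t x $ i) *\<^sub>R v) \<le> 1 / (4 * L) * norm (\<gamma> t x $ i)")
        case True
        have "(norm (\<gamma> t x $ i))\<^sup>2 \<le> 16 * (\<gamma> t x $ i \<bullet> E q r)\<^sup>2"
          using cone_inner_bound[OF True E] L by simp
        also have "\<dots> \<le> 16 * (norm (\<gamma> t x *v E q r))\<^sup>2"
        proof -
          have "\<bar>(\<gamma> t x *v E q r) $ i\<bar> \<le> norm (\<gamma> t x *v E q r)" by (rule component_le_norm_cart)
          then have "\<bar>(\<gamma> t x *v E q r) $ i\<bar>\<^sup>2 \<le> (norm (\<gamma> t x *v E q r))\<^sup>2" by (intro power_mono) auto
          then show ?thesis by (simp add: matrix_vector_mul_component)
        qed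
        finally show ?thesis using True by (simp add: G_def p ennreal_leI)
      qed (simp add: G_def p)
      also have "\<dots> = 16 * F q p"
        by (simp add: F_def p avg ennreal_mult)
      finally show ?thesis using True by simp
    qed simp
    then have "(\<integral>\<^sup>+p\<in>treebox r 0. G p \<partial>?H) \<le> (\<integral>\<^sup>+p. 16 * (F q p * indicator (treebox r 0) p) \<partial>?H)"
      by (intro nn_integral_mono) auto
    also have "\<dots> = 16 * (\<integral>\<^sup>+p\<in>treebox r 0. F q p \<partial>?H)"
      using F treebox_sets_halfspace[of r 0 w] by (intro nn_integral_cmult) auto
    finally show ?thesis .
  qed
  have F16: "16 * (\<integral>\<^sup>+p\<in>treebox r n. F q p \<partial>?H) < \<infinity>" for q r n
    using F_fin[of q r n] by (simp add: ennreal_mult_less_top)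
  \<comment> \<open>Each cube is not bad for its own test function, so the comparison holds on its
    upper half.\<close>
  have G_fin: "(\<integral>\<^sup>+p\<in>treebox q 0. G p \<partial>?H) < \<infinity>" for q
    using G_le[OF test_not_bad[OF T L c3]] F16 le_less_trans by blast
  define g where "g r = enn2real (\<integral>\<^sup>+p\<in>treebox r 0. G p \<partial>?H)" for r
  have gh: "g r \<le> 16 * h q r" if "\<not> bad L v (E q) r" for q r
  proof -
    have "g r \<le> enn2real (16 * (\<integral>\<^sup>+p\<in>treebox r 0. F q p \<partial>?H))"
      unfolding g_def using G_le[OF that] F16[of q r 0] by (intro enn2real_mono) auto
    then show ?thesis by (simp add: h_def enn2real_mult)
  qed
  have "\<exists>C. \<forall>n Q. psum (\<lambda>_. True) g n Q \<le> C * mass Q"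
  proof (rule tree_bound[OF L c3 v])
    show "0 \<le> C4\<^sup>2" by simp
    show "\<exists>E a h. test Q v c3 (C4\<^sup>2) E a h \<and> (\<forall>R. \<not> bad L v E R \<longrightarrow> g R \<le> 16 * h R)" for Q
      using T[of Q] gh[of Q] by blast
  qed
  then obtain C where C: "psum (\<lambda>_. True) g n Q \<le> C * mass Q" for n Q by blast
  have "(\<integral>\<^sup>+p\<in>treebox q n. G p \<partial>?H) \<le> ennreal (max 0 C * mass q)" for n q
  proof -
    have "(\<integral>\<^sup>+p\<in>treebox q n. G p \<partial>?H) = ennreal (psum (\<lambda>_. True) g n q)"
      unfolding g_def psum_nn_integral[OF G G_fin] ..
    also have "\<dots> \<le> ennreal (max 0 C * mass q)"
    proof (rule ennreal_leI)
      have "C * mass q \<le> max 0 C * mass q" using mass_pos[of q] by (intro mult_right_mono) auto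
      then show "psum (\<lambda>_. True) g n q \<le> max 0 C * mass q" using C[of n q] by linarith
    qed
    finally show ?thesis .
  qed
  then show "\<exists>C\<ge>0. \<forall>n q. (\<integral>\<^sup>+p\<in>treebox q n. G p \<partial>?H) \<le> ennreal (C * mass q)"
    by (intro exI[of _ "max 0 C"]) auto
qed

end

theorem theorem1p1:
  fixes w :: "real ^ 'n \<Rightarrow> real"
    and \<mu> :: "(real ^ 'n) measure"
    and W :: "real ^ 'n \<Rightarrow> real ^ 'N ^ 'N"
    and \<gamma> :: "real \<Rightarrow> real ^ 'n \<Rightarrow> real ^ 'N ^ 'M"
    and b :: "(real ^ 'n) set \<Rightarrow> real ^ 'N \<Rightarrow> real ^ 'n \<Rightarrow> real ^ 'N"
    and C1 C2 C3 C4 :: real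
  assumes w_meas: "w \<in> borel_measurable lebesgue"
    and w_nonneg: "\<And>x. 0 \<le> w x"
    and mu: "\<mu> = weighted_measure w"
    and doubling: "doubling C1 \<mu>"
    and W_meas: "W \<in> borel_measurable lebesgue"
    and W_pos: "AE x in lebesgue. positive_definite (W x)"
    and W_int: "\<And>Q. Q \<in> cubes \<Longrightarrow> set_integrable \<mu> Q W"
    and W2_int: "\<And>Q. Q \<in> cubes \<Longrightarrow> set_integrable \<mu> Q (\<lambda>x. W x ** W x)"
    and W_det: "\<And>Q. Q \<in> cubes \<Longrightarrow>
      det (average \<mu> Q (\<lambda>x. W x ** W x)) \<le> C2\<^sup>2 * geometric_mean \<mu> Q (\<lambda>x. det (W x ** W x))"
    and gamma_meas: "(\<lambda>(t, x). \<gamma> t x) \<in> borel_measurable (lebesgue_on ({0<..} \<times> UNIV))"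
    and b_L2: "\<And>Q v. Q \<in> dyadic_cubes \<Longrightarrow> norm v = 1 \<Longrightarrow> b Q v \<in> L2 \<mu>"
    and b_avg: "\<And>Q v. Q \<in> dyadic_cubes \<Longrightarrow> norm v = 1 \<Longrightarrow>
      v \<bullet> weighted_average \<mu> W Q (b Q v) = 1"
    and b_bound: "\<And>Q v. Q \<in> dyadic_cubes \<Longrightarrow> norm v = 1 \<Longrightarrow>
      (LINT x|\<mu>. (norm (b Q v x))\<^sup>2) \<le> C3\<^sup>2 * measure \<mu> Q"
    and b_carleson: "\<And>Q v. Q \<in> dyadic_cubes \<Longrightarrow> norm v = 1 \<Longrightarrow>
      (\<integral>\<^sup>+(t, x). ennreal ((norm (\<gamma> t x *v dyadic_averaging \<mu> W t (b Q v) x))\<^sup>2) \<partial>halfspace_measure w)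
        \<le> ennreal (C4\<^sup>2) * emeasure \<mu> Q"
  shows "(SUP Q\<in>dyadic_cubes.
      (\<integral>\<^sup>+(t, x)\<in>carleson_box Q. ennreal ((onorm ((*v) (\<gamma> t x)))\<^sup>2) \<partial>halfspace_measure w)
        / emeasure \<mu> Q) < \<infinity>"
proof -
  interpret matrix_weight w \<mu> W C1 C2
    using assms by unfold_locales
  let ?H = "halfspace_measure w"
  have gamma_meas': "(\<lambda>(t, x). \<gamma> t x) \<in> borel_measurable ?H"
    using gamma_meas by (subst measurable_cong_sets[OF sets_halfspace refl])
  \<comment> \<open>The tree argument bounds the squared norm of a test function, hence the square;
    the added 1 ensures \<open>1 <= c3\<close>.\<close>
  define c3 where "c3 = C3\<^sup>2 + 1"
  define L where "L = threshold c3"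
  define G where "G i v = (\<lambda>(t, x). ennreal ((norm (\<gamma> t x $ i))\<^sup>2) *
    indicator {y. norm (y - norm y *\<^sub>R v) \<le> 1 / (4 * L) * norm y} (\<gamma> t x $ i))" for i v
  have dy: "dcube q \<in> dyadic_cubes" for q :: "int \<times> (int^'n)" by (simp add: dyadic_cubes_eq)
  have c3: "1 \<le> c3" by (simp add: c3_def)
  have bound3: "(LINT x|\<mu>. (norm (b (dcube q) v x))\<^sup>2) \<le> c3 * mass q" if "norm v = 1" for q v
    using b_bound[OF dy that, of q] mass_pos[of q] by (simp add: c3_def mass_def distrib_right)
  have G: "G i v \<in> borel_measurable ?H"
    "\<exists>C\<ge>0. \<forall>n q. (\<integral>\<^sup>+p\<in>treebox q n. G i v p \<partial>?H) \<le> ennreal (C * mass q)" if "norm v = 1" for i v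
    unfolding G_def L_def
    using cone_carleson_bound[OF that c3 gamma_meas', of "\<lambda>Q. b Q v" C4 i]
      b_L2[OF dy that] b_avg[OF dy that] bound3[OF that] b_carleson[OF dy that] by blast+
  have "0 < 1 / (4 * L)" using threshold(2)[of c3] by (simp add: L_def)
  then obtain V :: "(real^'N) set" where V: "finite V" "\<And>v. v \<in> V \<Longrightarrow> norm v = 1"
    "\<And>y. y \<noteq> 0 \<Longrightarrow> \<exists>v\<in>V. norm (y - norm y *\<^sub>R v) \<le> 1 / (4 * L) * norm y"
    using finite_net_sphere by metis
  have "\<forall>i v. \<exists>C\<ge>0. norm v = 1 \<longrightarrow> (\<forall>n q. (\<integral>\<^sup>+p\<in>treebox q n. G i v p \<partial>?H) \<le> ennreal (C * mass q))"
    using G(2) by (metis order_refl)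
  then obtain C where C: "\<And>i v. 0 \<le> C i v"
    "\<And>i v n q. norm v = 1 \<Longrightarrow> (\<integral>\<^sup>+p\<in>treebox q n. G i v p \<partial>?H) \<le> ennreal (C i v * mass q)"
    by metis
  define K where "K = (\<Sum>i\<in>UNIV. \<Sum>v\<in>V. C i v)"
  \<comment> \<open>The Hilbert-Schmidt norm dominates the operator norm and splits into rows, and
    every nonzero row lies in one of the cones.\<close>
  have pointwise: "ennreal ((onorm ((*v) (\<gamma> t x)))\<^sup>2) \<le> (\<Sum>i\<in>UNIV. \<Sum>v\<in>V. G i v (t, x))" for t x
  proof -
    have "onorm ((*v) (\<gamma> t x)) \<le> norm (\<gamma> t x)"
      by (rule onorm_le) (rule norm_matrix_vector_mult_le)
    moreover have "0 \<le> onorm ((*v) (\<gamma> t x))"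
      by (rule onorm_pos_le) (rule matrix_vector_mul_bounded_linear)
    ultimately have "(onorm ((*v) (\<gamma> t x)))\<^sup>2 \<le> (\<Sum>i\<in>UNIV. (norm (\<gamma> t x $ i))\<^sup>2)"
      unfolding norm_matrix_power2[symmetric] by (intro power_mono)
    then have "ennreal ((onorm ((*v) (\<gamma> t x)))\<^sup>2) \<le> (\<Sum>i\<in>UNIV. ennreal ((norm (\<gamma> t x $ i))\<^sup>2))"
      by (subst sum_ennreal) (auto intro: ennreal_leI)
    also have "\<dots> \<le> (\<Sum>i\<in>UNIV. \<Sum>v\<in>V. G i v (t, x))"
    proof (rule sum_mono)
      fix i
      show "ennreal ((norm (\<gamma> t x $ i))\<^sup>2) \<le> (\<Sum>v\<in>V. G i v (t, x))"
      proof (cases "\<gamma> t x $ i = 0")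
        case False
        then obtain v where "v \<in> V"
          "norm (\<gamma> t x $ i - norm (\<gamma> t x $ i) *\<^sub>R v) \<le> 1 / (4 * L) * norm (\<gamma> t x $ i)"
          using V(3) by blast
        then have "ennreal ((norm (\<gamma> t x $ i))\<^sup>2) = G i v (t, x)" by (simp add: G_def)
        also have "\<dots> \<le> (\<Sum>v\<in>V. G i v (t, x))"
          using V(1) \<open>v \<in> V\<close> by (intro member_le_sum) auto
        finally show ?thesis .
      qed simp
    qed
    finally show ?thesis .
  qed
  have "(\<integral>\<^sup>+(t, x)\<in>carleson_box (dcube q). ennreal ((onorm ((*v) (\<gamma> t x)))\<^sup>2) \<partial>?H) / emeasure \<mu> (dcube q)
      \<le> ennreal K" for q
  proof (rule divide_le_posI_ennreal[OF emeasure_dcube(1)])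
    have "(\<integral>\<^sup>+(t, x)\<in>carleson_box (dcube q). ennreal ((onorm ((*v) (\<gamma> t x)))\<^sup>2) \<partial>?H)
        \<le> (\<integral>\<^sup>+p\<in>carleson_box (dcube q). (\<Sum>i\<in>UNIV. \<Sum>v\<in>V. G i v p) \<partial>?H)"
      using pointwise by (intro nn_integral_mono) (auto simp: indicator_def)
    also have "\<dots> \<le> ennreal (K * mass q)"
    proof (rule nn_integral_carleson_box_le)
      show "(\<lambda>p. \<Sum>i\<in>UNIV. \<Sum>v\<in>V. G i v p) \<in> borel_measurable ?H"
        using G(1) V(2) by (intro borel_measurable_sum) auto
      show "treebox q n \<in> sets ?H" for n by (rule treebox_sets_halfspace)
      show "(\<integral>\<^sup>+p\<in>treebox q n. (\<Sum>i\<in>UNIV. \<Sum>v\<in>V. G i v p) \<partial>?H) \<le> ennreal (K * mass q)" for n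
      proof -
        have meas: "(\<lambda>p. G i v p * indicator (treebox q n) p) \<in> borel_measurable ?H" if "v \<in> V" for i v
          using G(1)[OF V(2)[OF that]] treebox_sets_halfspace[of q n w] by auto
        have "(\<integral>\<^sup>+p\<in>treebox q n. (\<Sum>i\<in>UNIV. \<Sum>v\<in>V. G i v p) \<partial>?H)
            = (\<Sum>i\<in>UNIV. \<Sum>v\<in>V. \<integral>\<^sup>+p\<in>treebox q n. G i v p \<partial>?H)"
          unfolding sum_distrib_right using meas
          by (subst nn_integral_sum) (auto intro!: borel_measurable_sum sum.cong nn_integral_sum)
        also have "\<dots> \<le> (\<Sum>i\<in>UNIV. \<Sum>v\<in>V. ennreal (C i v * mass q))"
          using C(2) V(2) by (intro sum_mono) auto
        also have "\<dots> = ennreal (K * mass q)"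
          using C(1) mass_pos[of q] by (simp add: K_def sum_ennreal sum_nonneg sum_distrib_right less_imp_le)
        finally show ?thesis .
      qed
    qed
    also have "\<dots> = emeasure \<mu> (dcube q) * ennreal K"
      using C(1) mass_pos[of q]
      by (simp add: emeasure_dcube_eq ennreal_mult'[symmetric] K_def sum_nonneg mult.commute less_imp_le)
    finally show "(\<integral>\<^sup>+(t, x)\<in>carleson_box (dcube q). ennreal ((onorm ((*v) (\<gamma> t x)))\<^sup>2) \<partial>?H)
        \<le> emeasure \<mu> (dcube q) * ennreal K" .
  qed
  then have "(SUP Q\<in>dyadic_cubes.
      (\<integral>\<^sup>+(t, x)\<in>carleson_box Q. ennreal ((onorm ((*v) (\<gamma> t x)))\<^sup>2) \<partial>?H) / emeasure \<mu> Q) \<le> ennreal K"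
    unfolding dyadic_cubes_eq by (intro SUP_least) auto
  then show ?thesis by (rule le_less_trans) simp
qed

end
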